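(* Every large even Artin group is poly-free.
   Context: Let $\Gamma$ be a finite simple graph with vertex set $V$ and edge set $E$, each edge $e=\{u,v\}$ carrying an integer label $m_e\ge 2$. The Artin group is $A_\Gamma=\langle V \mid {}_{m_e}(uv)={}_{m_e}(vu) \text{ for } e=\{u,v\}\in E\rangle$, where ${}_{m}(uv)$ denotes the alternating product $uvu\cdots$ of length $m$. $A_\Gamma$ is even if every label $m_e$ is even, and large if $m_e\ge 3$ for every $e\in E$. A group $G$ is poly-free if there is a chain of subgroups $1=G_0\unlhd G_1\unlhd\cdots\unlhd G_N=G$, each normal in the next, such that every quotient $G_{i+1}/G_i$ is a free group. *)

theory Defs
  imports "HOL-Algebra.Algebra"
begin

text \<open>A letter (True, x) stands for the generator x, (False, x) for its inverse.\<close>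
type_synonym 'v word = "(bool \<times> 'v) list"

fun red :: "'v word \<Rightarrow> 'v word" where
  "red [] = []"
| "red (x # xs) = (case red xs of
      [] \<Rightarrow> [x]
    | y # ys \<Rightarrow> (if snd y = snd x \<and> fst y \<noteq> fst x then ys else x # y # ys))"

definition reduced :: "'v word \<Rightarrow> bool" where
  "reduced w \<longleftrightarrow> red w = w"

definition inv_word :: "'v word \<Rightarrow> 'v word" where
  "inv_word w = rev (map (\<lambda>(b, x). (\<not> b, x)) w)"

definition free_grp :: "'v set \<Rightarrow> 'v word monoid" where
  "free_grp Gen = \<lparr> carrier = {w. set (map snd w) \<subseteq> Gen \<and> reduced w},
                 monoid.mult = (\<lambda>u w. red (u @ w)), monoid.one = [] \<rparr>"

definition eval_word :: "('a, 'b) monoid_scheme \<Rightarrow> 'a word \<Rightarrow> 'a" where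
  "eval_word G w = foldr (\<lambda>(b, x) acc. (if b then x else inv\<^bsub>G\<^esub> x) \<otimes>\<^bsub>G\<^esub> acc) w \<one>\<^bsub>G\<^esub>"

definition is_free_group :: "('a, 'b) monoid_scheme \<Rightarrow> bool" where
  "is_free_group G \<longleftrightarrow> group G \<and>
     (\<exists>S \<subseteq> carrier G. generate G S = carrier G \<and>
        (\<forall>w. w \<noteq> [] \<and> reduced w \<and> set (map snd w) \<subseteq> S \<longrightarrow> eval_word G w \<noteq> \<one>\<^bsub>G\<^esub>))"

definition poly_free :: "('a, 'b) monoid_scheme \<Rightarrow> bool" where
  "poly_free G \<longleftrightarrow> group G \<and>
     (\<exists>(N::nat) (Gs :: nat \<Rightarrow> 'a set).
        Gs 0 = {\<one>\<^bsub>G\<^esub>} \<and> Gs N = carrier G \<and>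
        (\<forall>i<N. subgroup (Gs (Suc i)) G \<and>
               normal (Gs i) (G\<lparr>carrier := Gs (Suc i)\<rparr>) \<and>
               is_free_group ((G\<lparr>carrier := Gs (Suc i)\<rparr>) Mod (Gs i))))"

definition alt_word :: "'v \<Rightarrow> 'v \<Rightarrow> nat \<Rightarrow> 'v word" where
  "alt_word u v m = map (\<lambda>i. (True, if even i then u else v)) [0..<m]"

definition labelled_graph :: "'v set \<Rightarrow> 'v set set \<Rightarrow> ('v set \<Rightarrow> nat) \<Rightarrow> bool" where
  "labelled_graph V E m \<longleftrightarrow> finite V \<and>
     (\<forall>e\<in>E. \<exists>u v. u \<in> V \<and> v \<in> V \<and> u \<noteq> v \<and> e = {u, v}) \<and>
     (\<forall>e\<in>E. 2 \<le> m e)"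

definition artin_relators :: "'v set \<Rightarrow> 'v set set \<Rightarrow> ('v set \<Rightarrow> nat) \<Rightarrow> 'v word set" where
  "artin_relators V E m =
     {red (alt_word u v (m {u, v}) @ inv_word (alt_word v u (m {u, v}))) | u v. {u, v} \<in> E}"

definition normal_closure :: "('a, 'b) monoid_scheme \<Rightarrow> 'a set \<Rightarrow> 'a set" where
  "normal_closure G R = generate G {g \<otimes>\<^bsub>G\<^esub> r \<otimes>\<^bsub>G\<^esub> inv\<^bsub>G\<^esub> g | g r. g \<in> carrier G \<and> r \<in> R}"

definition artin_group :: "'v set \<Rightarrow> 'v set set \<Rightarrow> ('v set \<Rightarrow> nat) \<Rightarrow> 'v word set monoid" where
  "artin_group V E m = free_grp V Mod normal_closure (free_grp V) (artin_relators V E m)"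

definition even_artin :: "'v set set \<Rightarrow> ('v set \<Rightarrow> nat) \<Rightarrow> bool" where
  "even_artin E m \<longleftrightarrow> (\<forall>e\<in>E. even (m e))"

definition large_artin :: "'v set set \<Rightarrow> ('v set \<Rightarrow> nat) \<Rightarrow> bool" where
  "large_artin E m \<longleftrightarrow> (\<forall>e\<in>E. 3 \<le> m e)"

end

theory Submission
  imports Defs Complex_Main
begin

text \<open>
Remove a vertex \<open>z\<close> and let \<open>B\<close> be the Artin group of the remaining graph. Killing \<open>z\<close> retracts \<open>A\<close> onto
\<open>B\<close>, and by induction it suffices that the kernel is free. The kernel is generated by the conjugates
\<open>z\<^sub>h = h z h\<^sup>-\<^sup>1\<close> with \<open>h\<close> in \<open>B\<close>, subject to the relations
\<open>z\<^sub>h z\<^sub>h\<^sub>x \<dots> = z\<^sub>h\<^sub>x z\<^sub>h\<^sub>x\<^sub>x \<dots>\<close> (\<open>k\<close> factors on each side) for each neighbour \<open>x\<close> of \<open>z\<close> with label \<open>2 k\<close>.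
Each of these relations involves \<open>k + 1\<close> consecutive elements of a coset of \<open>\<langle>x\<rangle>\<close> and can be solved for either
extreme one. One has to choose what is eliminated so that no \<open>z\<^sub>h\<close> is eliminated twice and the process is
well-founded.

The choice is made in a quotient of \<open>B\<close> where \<open>(x y)\<^sup>p = 1\<close> for edges with label \<open>2 p\<close>. It acts on a Coxeter
group with two reflections for each generator \<open>x\<close>, in which a pair of simple reflections generates a finite group only
if it comes from an edge, and then its order is at least \<open>4\<close>. With respect to the Coxeter length every coset of
\<open>\<langle>x\<rangle>\<close> has a unique shortest element; one keeps it and the \<open>k - 1\<close> elements that follow it. Since two descents always
generate a finite group, no element is eliminated along two different lines.
\<close>

subsection \<open>Words, free groups and Artin groups\<close>

text \<open>No presentation of the kernel is ever derived. It suffices to solve all the relations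
  between the \<open>z\<^sub>h\<close> at once in the free group on the kept indices: a solution
  lets \<open>A\<close> act on the semidirect product of that free group and \<open>B\<close>, and a
  word in the kept conjugates then moves the identity to the element of the free group that it
  spells. Conversely the same relations, read in \<open>A\<close>, show that the kept conjugates
  generate the kernel.

  Largeness enters as k >= 2. Positions 0 and 1 of each line are then kept, so whatever is
  eliminated to the right lies at least two steps from the shortest element, and there no generator
  shortens. The obstacle is the other side: position -1 has to be expressed through position 1,
  which has the same length, so length alone cannot order the eliminations. Ties are broken by
  whether a shorter element is left through the copy \<open>True\<close> or \<open>False\<close> of
  a generator, and the absence of infinite chains between two adjacent levels has to be
  proved.\<close>

definition push :: "bool \<times> 'v \<Rightarrow> 'v word \<Rightarrow> 'v word" where
  "push x ys = (case ys of [] \<Rightarrow> [x]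
     | y # zs \<Rightarrow> if snd y = snd x \<and> fst y \<noteq> fst x then zs else x # y # zs)"

abbreviation no_cancel :: "'v word \<Rightarrow> bool" where
  "no_cancel \<equiv> successively (\<lambda>x y. snd y = snd x \<longrightarrow> fst y = fst x)"

lemma red_Cons: "red (x # w) = push x (red w)"
  by (simp add: push_def)

lemma no_cancel_red: "no_cancel (red w)"
  by (induction w) (auto simp: successively_Cons split: list.splits)

lemma red_no_cancel: "no_cancel w \<Longrightarrow> red w = w"
  by (induction w) (auto simp: successively_Cons split: list.splits)

lemma reduced_iff: "reduced w \<longleftrightarrow> no_cancel w"
  unfolding reduced_def using no_cancel_red[of w] red_no_cancel[of w] by (intro iffI) simp_all

lemma red_red [simp]: "red (red w) = red w"
  by (simp add: red_no_cancel no_cancel_red)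

lemma reduced_red [simp]: "reduced (red w)"
  by (simp add: reduced_def)

lemma set_red: "set (red w) \<subseteq> set w"
  by (induction w) (auto split: list.splits if_splits)

lemma letters_red: "snd ` set (red w) \<subseteq> snd ` set w"
  using set_red by (rule image_mono)

text \<open>This needs a reduced \<open>r\<close>: if \<open>y\<close> deletes the head of
  \<open>r\<close>, that head is \<open>x\<close>, and putting \<open>x\<close> back must not meet
  another letter \<open>y\<close>.\<close>

lemma push_cancel:
  assumes "no_cancel r" "snd y = snd x" "fst y \<noteq> fst x"
  shows "push x (push y r) = r"
  using assms by (cases r) (auto simp: push_def successively_Cons prod_eq_iff split: list.splits)

lemma red_append: "red (u @ w) = foldr push u (red w)"
  by (induction u) (simp_all add: red_Cons del: red.simps(2))

lemma red_append_right [simp]: "red (u @ red w) = red (u @ w)"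
  by (simp add: red_append)

text \<open>Confluence of free reduction, from which associativity in \<open>free_grp\<close>
  follows. The only real case is a letter that cancels the head of \<open>red u\<close>;
  \<open>push_cancel\<close> performs the same cancellation in front of \<open>w\<close>.\<close>

lemma red_append_left [simp]: "red (red u @ w) = red (u @ w)"
proof (induction u)
  case (Cons x u)
  have IH: "red (x # u @ w) = push x (red (red u @ w))"
    using Cons by (simp add: red_Cons del: red.simps(2))
  show ?case
  proof (cases "red u")
    case (Cons y zs)
    show ?thesis
    proof (cases "snd y = snd x \<and> fst y \<noteq> fst x")
      case True
      then have "push x (push y (red (zs @ w))) = red (zs @ w)"
        by (intro push_cancel no_cancel_red) auto
      then show ?thesis using IH Cons True by (simp add: red_Cons del: red.simps(2)) (simp add: push_def)
    next
      case False
      then have "red (x # u) = x # y # zs" using Cons by auto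
      then show ?thesis using IH Cons by (simp add: red_Cons del: red.simps(2))
    qed
  next
    case Nil
    then have "red (u @ w) = red w" using Cons.IH by simp
    then show ?thesis using Nil by (simp add: push_def)
  qed
qed simp

lemma red_inv_word: "red (inv_word w @ w) = []"
proof (induction w)
  case (Cons x w)
  have "red (inv_word (x # w) @ x # w) = red (inv_word w @ red ((\<not> fst x, snd x) # x # w))"
    by (simp add: inv_word_def case_prod_unfold del: red.simps(2))
  also have "red ((\<not> fst x, snd x) # x # w) = red w"
    unfolding red_Cons by (rule push_cancel) (auto simp: no_cancel_red)
  finally show ?case using Cons by simp
qed (simp add: inv_word_def)

lemma letters_inv_word: "snd ` set (inv_word w) = snd ` set w"
  by (force simp: inv_word_def)

lemma free_grp_group: "group (free_grp Gen)"
proof (rule groupI)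
  fix x y assume "x \<in> carrier (free_grp Gen)" "y \<in> carrier (free_grp Gen)"
  then have "snd ` set (red (x @ y)) \<subseteq> Gen"
    by (intro order_trans[OF letters_red]) (auto simp: free_grp_def)
  then show "x \<otimes>\<^bsub>free_grp Gen\<^esub> y \<in> carrier (free_grp Gen)"
    by (simp add: free_grp_def)
next
  fix x assume x: "x \<in> carrier (free_grp Gen)"
  have "snd ` set (red (inv_word x)) \<subseteq> Gen"
    using x by (intro order_trans[OF letters_red]) (simp add: letters_inv_word free_grp_def)
  then show "\<exists>y\<in>carrier (free_grp Gen). y \<otimes>\<^bsub>free_grp Gen\<^esub> x = \<one>\<^bsub>free_grp Gen\<^esub>"
    by (intro bexI[of _ "red (inv_word x)"]) (auto simp: free_grp_def red_inv_word)
qed (auto simp: free_grp_def reduced_def)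

text \<open>In \<open>eval_word\<close> the letters are group elements. Here they are indices with
  values assigned by \<gamma>, so that one word can be evaluated in several groups.\<close>

definition ev :: "('h, 'b) monoid_scheme \<Rightarrow> ('v \<Rightarrow> 'h) \<Rightarrow> 'v word \<Rightarrow> 'h" where
  "ev H \<gamma> w = foldr (\<lambda>(b, x) acc. (if b then \<gamma> x else inv\<^bsub>H\<^esub> (\<gamma> x)) \<otimes>\<^bsub>H\<^esub> acc) w \<one>\<^bsub>H\<^esub>"

lemma ev_Nil [simp]: "ev H \<gamma> [] = \<one>\<^bsub>H\<^esub>"
  by (simp add: ev_def)

lemma ev_Cons: "ev H \<gamma> (x # w) = (if fst x then \<gamma> (snd x) else inv\<^bsub>H\<^esub> (\<gamma> (snd x))) \<otimes>\<^bsub>H\<^esub> ev H \<gamma> w"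
  by (simp add: ev_def case_prod_unfold)

lemma eval_word_map: "eval_word H (map (map_prod id \<gamma>) w) = ev H \<gamma> w"
  by (induction w) (auto simp: eval_word_def ev_def)

context group
begin

lemma ev_closed: "\<gamma> ` snd ` set w \<subseteq> carrier G \<Longrightarrow> ev G \<gamma> w \<in> carrier G"
  by (induction w) (auto simp: ev_Cons)

lemma ev_append:
  "\<gamma> ` snd ` set u \<subseteq> carrier G \<Longrightarrow> \<gamma> ` snd ` set w \<subseteq> carrier G \<Longrightarrow>
    ev G \<gamma> (u @ w) = ev G \<gamma> u \<otimes> ev G \<gamma> w"
  by (induction u) (auto simp: ev_Cons ev_closed m_assoc)

lemma ev_push:
  assumes "\<gamma> (snd x) \<in> carrier G" "\<gamma> ` snd ` set w \<subseteq> carrier G"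
  shows "ev G \<gamma> (push x w) = ev G \<gamma> (x # w)"
proof (cases w)
  case (Cons y zs)
  have "ev G \<gamma> zs \<in> carrier G" "\<gamma> (snd y) \<in> carrier G" using assms Cons ev_closed by auto
  then show ?thesis
    using assms Cons by (auto simp: push_def ev_Cons m_assoc[symmetric])
qed (simp add: push_def)

lemma ev_red: "\<gamma> ` snd ` set w \<subseteq> carrier G \<Longrightarrow> ev G \<gamma> (red w) = ev G \<gamma> w"
proof (induction w)
  case (Cons x w)
  have "\<gamma> ` snd ` set (red w) \<subseteq> carrier G" using Cons.prems set_red[of w] by auto
  then show ?case
    using Cons ev_push[of \<gamma> x "red w"] by (simp add: red_Cons ev_Cons del: red.simps(2))
qed simp

lemma ev_inv_word: "\<gamma> ` snd ` set w \<subseteq> carrier G \<Longrightarrow> ev G \<gamma> (inv_word w) = inv (ev G \<gamma> w)"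
proof (induction w)
  case (Cons x w)
  have s: "\<gamma> ` snd ` set (inv_word w) \<subseteq> carrier G"
    using Cons.prems letters_inv_word[of w] by auto
  have "inv_word (x # w) = inv_word w @ [(\<not> fst x, snd x)]"
    by (simp add: inv_word_def case_prod_unfold)
  then have "ev G \<gamma> (inv_word (x # w)) = ev G \<gamma> (inv_word w) \<otimes> ev G \<gamma> [(\<not> fst x, snd x)]"
    using Cons.prems s by (simp add: ev_append)
  then show ?case
    using Cons ev_closed[of \<gamma> w] by (auto simp: ev_Cons inv_mult_group)
qed (simp add: inv_word_def)

lemma ev_alt_word:
  assumes "\<gamma> u \<in> carrier G" "\<gamma> v \<in> carrier G"
  shows "ev G \<gamma> (alt_word u v (2 * p)) = (\<gamma> u \<otimes> \<gamma> v) [^] p"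
proof (induction p)
  case (Suc p)
  have "alt_word u v (2 * Suc p) = alt_word u v (2 * p) @ [(True, u), (True, v)]"
    by (simp add: alt_word_def)
  moreover have "\<gamma> ` snd ` set (alt_word u v (2 * p)) \<subseteq> carrier G"
    using assms by (auto simp: alt_word_def)
  ultimately show ?case using assms Suc by (simp add: ev_append ev_Cons)
qed (simp add: alt_word_def)

lemma ev_hom_free_grp:
  assumes "\<gamma> ` Gen \<subseteq> carrier G"
  shows "ev G \<gamma> \<in> hom (free_grp Gen) G"
proof (rule homI)
  have c: "\<gamma> ` snd ` set x \<subseteq> carrier G" if "x \<in> carrier (free_grp Gen)" for x
  proof -
    have "snd ` set x \<subseteq> Gen" using that by (simp add: free_grp_def)
    then show ?thesis using assms by blast
  qed
  fix x y assume xy: "x \<in> carrier (free_grp Gen)" "y \<in> carrier (free_grp Gen)"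
  show "ev G \<gamma> (x \<otimes>\<^bsub>free_grp Gen\<^esub> y) = ev G \<gamma> x \<otimes> ev G \<gamma> y"
    using ev_red[of \<gamma> "x @ y"] c[OF xy(1)] c[OF xy(2)]
    by (simp add: free_grp_def ev_append image_Un)
  show "ev G \<gamma> x \<in> carrier G" by (rule ev_closed[OF c[OF xy(1)]])
qed

end

lemma (in group) normal_closure_normal:
  assumes "R \<subseteq> carrier G"
  shows "normal_closure G R \<lhd> G" "R \<subseteq> normal_closure G R"
proof -
  let ?C = "{g \<otimes>\<^bsub>G\<^esub> r \<otimes>\<^bsub>G\<^esub> inv\<^bsub>G\<^esub> g | g r. g \<in> carrier G \<and> r \<in> R}"
  show "normal_closure G R \<lhd> G"
    unfolding normal_closure_def
  proof (rule normal_generateI)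
    show "?C \<subseteq> carrier G" using assms by auto
    fix h g assume "h \<in> ?C" and g: "g \<in> carrier G"
    then obtain k r where kr: "k \<in> carrier G" "r \<in> R" "h = k \<otimes> r \<otimes> inv k" by auto
    then have "g \<otimes> h \<otimes> inv g = (g \<otimes> k) \<otimes> r \<otimes> inv (g \<otimes> k)"
      using g assms by (simp add: inv_mult_group m_assoc subset_iff)
    then show "g \<otimes> h \<otimes> inv g \<in> ?C" using kr g by blast
  qed
  show "R \<subseteq> normal_closure G R"
  proof
    fix r assume "r \<in> R"
    then have "r = \<one> \<otimes> r \<otimes> inv \<one>" using assms by auto
    then have "r \<in> ?C" using \<open>r \<in> R\<close> by blast
    then show "r \<in> normal_closure G R" unfolding normal_closure_def by (rule generate.incl)
  qed
qed

lemma normal_closure_least: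
  assumes "group G" "R \<subseteq> K" "K \<lhd> G"
  shows "normal_closure G R \<subseteq> K"
proof -
  interpret K: normal K G by fact
  show ?thesis
    unfolding normal_closure_def
    using assms(2) by (intro K.generate_subgroup_incl K.subgroup_axioms) (auto intro: K.inv_op_closed2)
qed

section \<open>Even Artin groups: presentation and universal property\<close>

locale even_graph =
  fixes V :: "'v set" and E :: "'v set set" and m :: "'v set \<Rightarrow> nat"
  assumes graph: "labelled_graph V E m" and even_m: "even_artin E m"
begin

abbreviation "A \<equiv> artin_group V E m"
abbreviation "N \<equiv> normal_closure (free_grp V) (artin_relators V E m)"

definition gen :: "'v \<Rightarrow> 'v word set" where
  "gen v = N #>\<^bsub>free_grp V\<^esub> [(True, v)]"

text \<open>An alternating word of length \<open>2 * p\<close> is a p-th power, so every Artin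
  relation takes the form (u v)^p = (v u)^p.\<close>

definition half :: "'v set \<Rightarrow> nat" where
  "half e = m e div 2"

lemma label: "e \<in> E \<Longrightarrow> m e = 2 * half e"
  using even_m by (auto simp: even_artin_def half_def)

lemma edge_vertices: "{u, v} \<in> E \<Longrightarrow> u \<in> V \<and> v \<in> V \<and> u \<noteq> v"
  using graph unfolding labelled_graph_def by (metis doubleton_eq_iff)

lemma relators_carrier: "artin_relators V E m \<subseteq> carrier (free_grp V)"
proof
  fix r assume "r \<in> artin_relators V E m"
  then obtain u v where uv: "{u, v} \<in> E"
    "r = red (alt_word u v (m {u, v}) @ inv_word (alt_word v u (m {u, v})))"
    by (auto simp: artin_relators_def)
  have "snd ` set r \<subseteq> snd ` set (alt_word u v (m {u, v}) @ inv_word (alt_word v u (m {u, v})))"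
    unfolding uv(2) by (rule letters_red)
  also have "\<dots> \<subseteq> V" using edge_vertices[OF uv(1)]
    unfolding set_append image_Un letters_inv_word by (auto simp: alt_word_def)
  finally show "r \<in> carrier (free_grp V)" using uv by (simp add: free_grp_def)
qed

lemma N_normal: "N \<lhd> free_grp V"
  by (rule group.normal_closure_normal(1)[OF free_grp_group relators_carrier])

sublocale group A
  unfolding artin_group_def using N_normal by (rule normal.factorgroup_is_group)

lemma gen_closed: "v \<in> V \<Longrightarrow> gen v \<in> carrier A"
proof -
  assume "v \<in> V"
  then have "[(True, v)] \<in> carrier (free_grp V)" by (simp add: free_grp_def reduced_def)
  then show ?thesis by (auto simp: gen_def artin_group_def FactGroup_def RCOSETS_def)
qed

lemma universal:
  assumes H: "group H" and \<phi>: "\<And>v. v \<in> V \<Longrightarrow> \<phi> v \<in> carrier H"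
    and rel: "\<And>u v. {u, v} \<in> E \<Longrightarrow>
      (\<phi> u \<otimes>\<^bsub>H\<^esub> \<phi> v) [^]\<^bsub>H\<^esub> half {u, v} = (\<phi> v \<otimes>\<^bsub>H\<^esub> \<phi> u) [^]\<^bsub>H\<^esub> half {u, v}"
  obtains h where "h \<in> hom A H" "\<And>v. v \<in> V \<Longrightarrow> h (gen v) = \<phi> v"
proof -
  interpret H: group H by fact
  have hom: "ev H \<phi> \<in> hom (free_grp V) H" using \<phi> by (intro H.ev_hom_free_grp) auto
  interpret h: group_hom "free_grp V" H "ev H \<phi>"
    using hom H free_grp_group by (simp add: group_hom_def group_hom_axioms_def)
  have "artin_relators V E m \<subseteq> kernel (free_grp V) H (ev H \<phi>)"
  proof
    fix r assume r: "r \<in> artin_relators V E m"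
    then obtain u v where uv: "{u, v} \<in> E"
      "r = red (alt_word u v (m {u, v}) @ inv_word (alt_word v u (m {u, v})))"
      by (auto simp: artin_relators_def)
    have c: "\<phi> u \<in> carrier H" "\<phi> v \<in> carrier H" using edge_vertices[OF uv(1)] \<phi> by auto
    have s: "\<phi> ` snd ` set (alt_word u v k) \<subseteq> carrier H" "\<phi> ` snd ` set (alt_word v u k) \<subseteq> carrier H" for k
      using c by (auto simp: alt_word_def)
    then have "ev H \<phi> r = ev H \<phi> (alt_word u v (2 * half {u, v})) \<otimes>\<^bsub>H\<^esub> inv\<^bsub>H\<^esub> ev H \<phi> (alt_word v u (2 * half {u, v}))"
      unfolding uv(2) label[OF uv(1)]
      by (subst H.ev_red) (auto simp: letters_inv_word image_Un H.ev_append H.ev_inv_word)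
    then have "ev H \<phi> r = \<one>\<^bsub>H\<^esub>"
      using rel[OF uv(1)] c by (simp add: H.ev_alt_word)
    then show "r \<in> kernel (free_grp V) H (ev H \<phi>)"
      using r relators_carrier by (auto simp: kernel_def)
  qed
  then have "N \<subseteq> kernel (free_grp V) H (ev H \<phi>)"
    by (intro normal_closure_least free_grp_group h.normal_kernel)
  with N_normal obtain g where g: "g \<in> hom (free_grp V Mod N) H"
    "\<And>x. x \<in> carrier (free_grp V) \<Longrightarrow> g (N #>\<^bsub>free_grp V\<^esub> x) = ev H \<phi> x"
    using h.FactGroup_universal_kernel by blast
  have "g (gen v) = \<phi> v" if "v \<in> V" for v
    using that \<phi> g(2)[of "[(True, v)]"] by (simp add: gen_def free_grp_def reduced_def ev_Cons)
  then show thesis using g(1) that by (simp add: artin_group_def)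
qed

text \<open>The bridge from cosets to products of generators, on which \<open>relation\<close> and
  \<open>gen_induct\<close> rest. Only reduced words belong to \<open>free_grp V\<close>, hence
  \<open>red w\<close> on the left.\<close>

lemma coset_red_eq_ev:
  "snd ` set w \<subseteq> V \<Longrightarrow> N #>\<^bsub>free_grp V\<^esub> red w = ev A gen w"
proof (induction w)
  case Nil
  interpret N: normal N "free_grp V" by (rule N_normal)
  have "N #>\<^bsub>free_grp V\<^esub> \<one>\<^bsub>free_grp V\<^esub> = N"
    by (rule N.coset_join2[OF N.one_closed N.subgroup_axioms subgroup.one_closed[OF N.subgroup_axioms]])
  moreover have "\<one>\<^bsub>free_grp V\<^esub> = []" by (simp add: free_grp_def)
  ultimately show ?case by (simp add: artin_group_def FactGroup_def)
next
  case (Cons x w)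
  interpret N: normal N "free_grp V" by (rule N_normal)
  let ?F = "free_grp V"
  have xV: "snd x \<in> V" and wV: "snd ` set w \<subseteq> V" using Cons.prems by auto
  have cw: "red w \<in> carrier ?F" using wV set_red[of w] by (auto simp: free_grp_def)
  have cx: "[x] \<in> carrier ?F" "[(True, snd x)] \<in> carrier ?F" using xV by (auto simp: free_grp_def reduced_def)
  have mult: "N #>\<^bsub>?F\<^esub> (a \<otimes>\<^bsub>?F\<^esub> b) = (N #>\<^bsub>?F\<^esub> a) \<otimes>\<^bsub>A\<^esub> (N #>\<^bsub>?F\<^esub> b)"
    if "a \<in> carrier ?F" "b \<in> carrier ?F" for a b
    using that N.rcos_sum by (simp add: artin_group_def FactGroup_def)
  have invF: "[x] = inv\<^bsub>?F\<^esub> [(True, snd x)]" if "\<not> fst x"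
  proof -
    have "[x] \<otimes>\<^bsub>?F\<^esub> [(True, snd x)] = \<one>\<^bsub>?F\<^esub>"
      using that by (simp add: free_grp_def)
    then show ?thesis using cx by (metis N.inv_equality)
  qed
  have "N #>\<^bsub>?F\<^esub> [x] = (if fst x then gen (snd x) else inv\<^bsub>A\<^esub> gen (snd x))"
  proof (cases "fst x")
    case True
    then have "x = (True, snd x)" by (cases x) auto
    then show ?thesis using True by (metis gen_def)
  next
    case False
    then show ?thesis
      using N.inv_FactGroup[of "gen (snd x)"] N.rcos_inv[OF cx(2)] gen_closed[OF xV] invF
      by (simp add: artin_group_def gen_def)
  qed
  note x = this
  have "[x] \<otimes>\<^bsub>?F\<^esub> red w = red ([x] @ red w)"
    by (simp add: free_grp_def)
  also have "\<dots> = red (x # w)" unfolding red_append_right by simp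
  finally have "N #>\<^bsub>?F\<^esub> red (x # w) = (N #>\<^bsub>?F\<^esub> [x]) \<otimes>\<^bsub>A\<^esub> (N #>\<^bsub>?F\<^esub> red w)"
    using mult[OF cx(1) cw] by (simp only:)
  then show ?case
    unfolding x Cons.IH[OF wV] ev_Cons .
qed

lemma carrier_eq_ev: "a \<in> carrier A \<Longrightarrow> \<exists>w. snd ` set w \<subseteq> V \<and> a = ev A gen w"
proof -
  assume "a \<in> carrier A"
  then obtain w where "w \<in> carrier (free_grp V)" "a = N #>\<^bsub>free_grp V\<^esub> w"
    by (auto simp: artin_group_def FactGroup_def RCOSETS_def)
  then show ?thesis
    using coset_red_eq_ev[of w] by (auto simp: free_grp_def reduced_def)
qed

lemma relation:
  assumes uv: "{u, v} \<in> E"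
  shows "(gen u \<otimes>\<^bsub>A\<^esub> gen v) [^]\<^bsub>A\<^esub> half {u, v} = (gen v \<otimes>\<^bsub>A\<^esub> gen u) [^]\<^bsub>A\<^esub> half {u, v}"
proof -
  let ?a = "alt_word u v (m {u, v})" and ?b = "alt_word v u (m {u, v})"
  have V: "u \<in> V" "v \<in> V" using edge_vertices[OF uv] by auto
  have s: "snd ` set ?a \<subseteq> V" "snd ` set ?b \<subseteq> V"
    using V by (auto simp: alt_word_def)
  then have s': "gen ` snd ` set ?a \<subseteq> carrier A" "gen ` snd ` set ?b \<subseteq> carrier A"
    using gen_closed by auto
  have "red (?a @ inv_word ?b) \<in> N"
    using group.normal_closure_normal(2)[OF free_grp_group relators_carrier] uv
    by (auto simp: artin_relators_def)
  then have "N #>\<^bsub>free_grp V\<^esub> red (?a @ inv_word ?b) = N"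
    using normal_imp_subgroup[OF N_normal] free_grp_group
    by (meson group.coset_join2 subgroup.mem_carrier)
  moreover have "N #>\<^bsub>free_grp V\<^esub> red (?a @ inv_word ?b) = ev A gen (?a @ inv_word ?b)"
    using s by (intro coset_red_eq_ev) (auto simp: image_Un letters_inv_word)
  ultimately have "ev A gen (?a @ inv_word ?b) = \<one>\<^bsub>A\<^esub>"
    by (simp add: artin_group_def FactGroup_def)
  then have "ev A gen ?a \<otimes>\<^bsub>A\<^esub> inv\<^bsub>A\<^esub> ev A gen ?b = \<one>\<^bsub>A\<^esub>"
    using s' by (simp add: ev_append ev_inv_word letters_inv_word)
  then have "inv\<^bsub>A\<^esub> (inv\<^bsub>A\<^esub> (ev A gen ?b)) = ev A gen ?a"
    using s' by (intro inv_equality inv_closed ev_closed)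
  then have "ev A gen ?a = ev A gen ?b"
    using ev_closed[OF s'(2)] by simp
  then show ?thesis
    unfolding label[OF uv] using V gen_closed by (simp add: ev_alt_word)
qed

lemma gen_induct [consumes 1, case_names one gen inv_gen]:
  assumes "a \<in> carrier A" "P \<one>\<^bsub>A\<^esub>"
    and "\<And>a v. a \<in> carrier A \<Longrightarrow> P a \<Longrightarrow> v \<in> V \<Longrightarrow> P (a \<otimes>\<^bsub>A\<^esub> gen v)"
    and "\<And>a v. a \<in> carrier A \<Longrightarrow> P a \<Longrightarrow> v \<in> V \<Longrightarrow> P (a \<otimes>\<^bsub>A\<^esub> inv\<^bsub>A\<^esub> gen v)"
  shows "P a"
proof -
  have c: "ev A gen w \<in> carrier A" if "snd ` set w \<subseteq> V" for w
    using that gen_closed by (intro ev_closed) auto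
  have "P (ev A gen w)" if "snd ` set w \<subseteq> V" for w
    using that
  proof (induction w rule: rev_induct)
    case (snoc x w)
    then have V: "snd x \<in> V" "snd ` set w \<subseteq> V" by auto
    then have x: "gen (snd x) \<in> carrier A" by (simp add: gen_closed)
    have w: "gen ` snd ` set w \<subseteq> carrier A" using V(2) gen_closed by blast
    have "ev A gen (w @ [x]) = ev A gen w \<otimes>\<^bsub>A\<^esub> (if fst x then gen (snd x) else inv\<^bsub>A\<^esub> gen (snd x))"
      using x w by (subst ev_append) (auto simp: ev_Cons)
    then show ?case using assms(3,4)[OF c[OF V(2)] snoc.IH[OF V(2)] V(1)] by simp
  qed (simp add: assms(2))
  then show ?thesis using carrier_eq_ev[OF assms(1)] by blast
qed

lemma hom_eqI:
  assumes "group H" "f \<in> hom A H" "g \<in> hom A H" "\<And>v. v \<in> V \<Longrightarrow> f (gen v) = g (gen v)" "a \<in> carrier A"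
  shows "f a = g a"
proof -
  interpret f: group_hom A H f using assms by (simp add: group_hom_def group_hom_axioms_def)
  interpret g: group_hom A H g using assms by (simp add: group_hom_def group_hom_axioms_def)
  show ?thesis
    using assms(5)
  proof (induction rule: gen_induct)
    case (gen a v)
    then show ?case using gen_closed[of v] assms(4)[of v] by simp
  next
    case (inv_gen a v)
    then show ?case using gen_closed[of v] assms(4)[of v] by simp
  qed simp
qed

end

subsection \<open>Extensions of poly-free groups\<close>

lemma reduced_map:
  assumes "inj_on f (snd ` set w)"
  shows "reduced (map (map_prod id f) w) \<longleftrightarrow> reduced w"
  unfolding reduced_iff successively_map
  by (intro successively_cong refl) (use assms in \<open>auto simp: inj_on_def\<close>)

lemma hom_ev:
  assumes "group G" "group H" "h \<in> hom G H" "\<gamma> ` snd ` set w \<subseteq> carrier G"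
  shows "h (ev G \<gamma> w) = ev H (h \<circ> \<gamma>) w"
proof -
  interpret group_hom G H h using assms by (simp add: group_hom_def group_hom_axioms_def)
  show ?thesis
    using assms(4) by (induction w) (simp_all add: ev_Cons G.ev_closed)
qed

lemma is_free_groupI:
  assumes G: "group G" and z: "z ` T \<subseteq> carrier G" "generate G (z ` T) = carrier G"
    and free: "\<And>w. w \<noteq> [] \<Longrightarrow> reduced w \<Longrightarrow> snd ` set w \<subseteq> T \<Longrightarrow> ev G z w \<noteq> \<one>\<^bsub>G\<^esub>"
  shows "is_free_group G"
proof -
  interpret group G by fact
  \<comment> \<open>Two indices with the same value would give a reduced word s t^-1 of trivial
    value.\<close>
  have inj: "inj_on z T"
  proof (rule inj_onI, rule ccontr)
    fix s t assume st: "s \<in> T" "t \<in> T" "z s = z t" "s \<noteq> t"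
    then have "ev G z [(True, s), (False, t)] \<noteq> \<one>\<^bsub>G\<^esub>"
      by (intro free) (auto simp: reduced_def)
    then show False using st z by (auto simp: ev_Cons)
  qed
  have "eval_word G w \<noteq> \<one>\<^bsub>G\<^esub>" if w: "w \<noteq> []" "reduced w" "set (map snd w) \<subseteq> z ` T" for w
  proof -
    let ?i = "inv_into T z"
    let ?v = "map (map_prod id ?i) w"
    have wz: "\<And>x. x \<in> set w \<Longrightarrow> snd x \<in> z ` T" using w(3) by auto
    then have "\<forall>x\<in>set w. z (?i (snd x)) = snd x"
      by (simp add: f_inv_into_f)
    then have "map (map_prod id z) ?v = w"
      by (auto simp: comp_def intro!: map_idI)
    moreover have "snd ` set ?v \<subseteq> T"
      using inv_into_into[OF wz] by fastforce
    moreover have "reduced ?v"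
      using w(2,3) by (subst reduced_map) (auto intro: inj_on_subset[OF inj_on_inv_into[OF subset_refl]])
    ultimately show ?thesis
      using free[of ?v] w(1) eval_word_map[of G z ?v] by simp
  qed
  then show ?thesis unfolding is_free_group_def using G z by blast
qed

lemma is_free_group_iso:
  assumes "is_free_group G" "group H" "h \<in> iso G H"
  shows "is_free_group H"
proof -
  obtain S where S: "group G" "S \<subseteq> carrier G" "generate G S = carrier G"
    "\<And>w. w \<noteq> [] \<Longrightarrow> reduced w \<Longrightarrow> set (map snd w) \<subseteq> S \<Longrightarrow> eval_word G w \<noteq> \<one>\<^bsub>G\<^esub>"
    using assms(1) unfolding is_free_group_def by blast
  have h: "h \<in> hom G H" "bij_betw h (carrier G) (carrier H)" using assms(3) by (auto simp: iso_def)
  interpret group_hom G H h using S(1) assms(2) h(1) by (simp add: group_hom_def group_hom_axioms_def)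
  show ?thesis
  proof (rule is_free_groupI[of H h S])
    show "h ` S \<subseteq> carrier H" using S(2) by auto
    show "generate H (h ` S) = carrier H"
      using generate_img[OF S(2)] S(3) h(2) by (simp add: bij_betw_def)
    fix w assume w: "w \<noteq> []" "reduced w" "snd ` set w \<subseteq> S"
    have c: "id ` snd ` set w \<subseteq> carrier G" using w(3) S(2) by auto
    have "ev G id w \<noteq> \<one>\<^bsub>G\<^esub>"
      using S(4)[of w] w eval_word_map[of G id w] by (simp add: map_prod.id)
    moreover have "ev G id w \<in> carrier G" by (rule G.ev_closed[OF c])
    ultimately have "h (ev G id w) \<noteq> \<one>\<^bsub>H\<^esub>"
      using h(2) hom_one G.one_closed by (metis bij_betw_def inj_on_eq_iff)
    then show "ev H h w \<noteq> \<one>\<^bsub>H\<^esub>"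
      using hom_ev[OF S(1) assms(2) h(1) c] by simp
  qed (fact assms(2))
qed

text \<open>The chain of \<open>H\<close> is pulled back along \<rho> and the trivial group is put
  below it. The new bottom quotient is the kernel, and the others are isomorphic to those of
  \<open>H\<close>.\<close>

lemma poly_free_extension:
  assumes \<rho>: "group_hom G H \<rho>" and surj: "\<rho> ` carrier G = carrier H"
    and free: "is_free_group (G\<lparr>carrier := kernel G H \<rho>\<rparr>)" and pf: "poly_free H"
  shows "poly_free G"
proof -
  interpret group_hom G H \<rho> by fact
  obtain n Hs where Hs: "Hs 0 = {\<one>\<^bsub>H\<^esub>}" "Hs n = carrier H"
    "\<And>i. i < n \<Longrightarrow> subgroup (Hs (Suc i)) H"
    "\<And>i. i < n \<Longrightarrow> normal (Hs i) (H\<lparr>carrier := Hs (Suc i)\<rparr>)"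
    "\<And>i. i < n \<Longrightarrow> is_free_group ((H\<lparr>carrier := Hs (Suc i)\<rparr>) Mod (Hs i))"
    using pf unfolding poly_free_def by blast
  define P where "P B = {g \<in> carrier G. \<rho> g \<in> B}" for B
  define Gs where "Gs i = (case i of 0 \<Rightarrow> {\<one>\<^bsub>G\<^esub>} | Suc j \<Rightarrow> P (Hs j))" for i
  have P_subgroup: "subgroup (P B) G" if "subgroup B H" for B
    unfolding P_def using that
    by (intro G.subgroupI)
      (auto intro: subgroup.one_closed subgroup.m_closed subgroup.m_inv_closed intro!: exI[of _ "\<one>\<^bsub>G\<^esub>"])
  have P1: "P (Hs 0) = kernel G H \<rho>" by (auto simp: P_def Hs kernel_def)
  have step: "subgroup (Gs (Suc i)) G \<and> normal (Gs i) (G\<lparr>carrier := Gs (Suc i)\<rparr>) \<and>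
       is_free_group ((G\<lparr>carrier := Gs (Suc i)\<rparr>) Mod (Gs i))" if i: "i < Suc n" for i
  proof (cases i)
    case 0
    let ?K = "G\<lparr>carrier := kernel G H \<rho>\<rparr>"
    have K: "group ?K" by (rule G.subgroup_imp_group[OF subgroup_kernel])
    have n: "{\<one>\<^bsub>G\<^esub>} \<lhd> ?K" using group.one_is_normal[OF K] by simp
    have "the_elem \<in> iso (?K Mod {\<one>\<^bsub>G\<^esub>}) ?K" using group.trivial_factor_iso[OF K] by simp
    then have "inv_into (carrier (?K Mod {\<one>\<^bsub>G\<^esub>})) the_elem \<in> iso ?K (?K Mod {\<one>\<^bsub>G\<^esub>})"
      by (rule group.iso_set_sym[OF normal.factorgroup_is_group[OF n]])
    then have "is_free_group (?K Mod {\<one>\<^bsub>G\<^esub>})"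
      by (rule is_free_group_iso[OF free normal.factorgroup_is_group[OF n]])
    then show ?thesis using 0 n P1 subgroup_kernel by (simp add: Gs_def)
  next
    case (Suc j)
    then have j: "j < n" using i by simp
    let ?H = "H\<lparr>carrier := Hs (Suc j)\<rparr>" and ?G = "G\<lparr>carrier := P (Hs (Suc j))\<rparr>"
    let ?Q = "?H Mod Hs j"
    interpret N: normal "Hs j" ?H by (rule Hs(4)[OF j])
    have sub: "subgroup (P (Hs (Suc j))) G" by (rule P_subgroup[OF Hs(3)[OF j]])
    have gG: "group ?G" by (rule G.subgroup_imp_group[OF sub])
    have gQ: "group ?Q" by (rule N.factorgroup_is_group)
    let ?f = "\<lambda>g. Hs j #>\<^bsub>?H\<^esub> \<rho> g"
    have "\<rho> \<in> hom ?G ?H" by (auto simp: hom_def P_def)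
    then have "?f \<in> hom ?G ?Q"
      using Group.hom_compose[OF _ N.r_coset_hom_Mod] by (simp add: comp_def)
    then interpret f: group_hom ?G ?Q ?f
      using gG gQ by (simp add: group_hom_def group_hom_axioms_def)
    have ker: "kernel ?G ?Q ?f = P (Hs j)"
    proof -
      have "Hs j #>\<^bsub>?H\<^esub> x = Hs j \<longleftrightarrow> x \<in> Hs j" if "x \<in> Hs (Suc j)" for x
        using that N.coset_join1[of "Hs j" x] N.coset_join2[of x "Hs j"] N.subgroup_axioms N.subset
        by auto
      then show ?thesis
        using N.subset by (auto simp: kernel_def P_def FactGroup_def)
    qed
    have img: "\<rho> ` P (Hs (Suc j)) = Hs (Suc j)"
      using surj subgroup.subset[OF Hs(3)[OF j]] by (auto simp: P_def image_iff)
    have "?f ` carrier ?G = (\<lambda>h. Hs j #>\<^bsub>?H\<^esub> h) ` \<rho> ` P (Hs (Suc j))"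
      by (simp add: image_image)
    also have "\<dots> = carrier ?Q"
      unfolding img by (auto simp: FactGroup_def RCOSETS_def)
    finally have "?f ` carrier ?G = carrier ?Q" .
    from f.FactGroup_iso_set[OF this]
    have "(\<lambda>C. the_elem (?f ` C)) \<in> iso (?G Mod P (Hs j)) ?Q" unfolding ker .
    moreover have n: "P (Hs j) \<lhd> ?G" using f.normal_kernel unfolding ker .
    ultimately have "inv_into (carrier (?G Mod P (Hs j))) (\<lambda>C. the_elem (?f ` C)) \<in> iso ?Q (?G Mod P (Hs j))"
      by (intro group.iso_set_sym normal.factorgroup_is_group)
    then have "is_free_group (?G Mod P (Hs j))"
      by (rule is_free_group_iso[OF Hs(5)[OF j] normal.factorgroup_is_group[OF n]])
    then show ?thesis using Suc n sub by (simp add: Gs_def)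
  qed
  have "Gs (Suc n) = carrier G" by (auto simp: Gs_def P_def Hs(2))
  moreover have "Gs 0 = {\<one>\<^bsub>G\<^esub>}" by (simp add: Gs_def)
  ultimately show ?thesis
    unfolding poly_free_def using step G.is_group by blast
qed

subsection \<open>The numbers game\<close>

text \<open>The numbers game of Mozes is the dual Tits representation of a Coxeter group: \<open>f u\<close> is the value
of a functional \<open>f\<close> on the simple root \<open>u\<close>, and firing \<open>s\<close> applies the reflection \<open>s\<close>. The value
\<open>cox s t = 0\<close> stands for an infinite Coxeter label; \<open>\<beta>\<close> is the negative of the Tits form.\<close>

locale numbers_game =
  fixes \<beta> :: "'s \<Rightarrow> 's \<Rightarrow> real" and cox :: "'s \<Rightarrow> 's \<Rightarrow> nat"
  assumes beta_refl: "\<beta> s s = -1"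
    and beta_sym: "\<beta> s t = \<beta> t s"
    and cox_sym: "cox s t = cox t s"
    and beta_inf: "s \<noteq> t \<Longrightarrow> cox s t = 0 \<Longrightarrow> \<beta> s t = 1"
    and cox_ge2: "cox s t \<noteq> 0 \<Longrightarrow> 2 \<le> cox s t"
    and beta_fin: "s \<noteq> t \<Longrightarrow> cox s t \<noteq> 0 \<Longrightarrow> \<beta> s t = cos (pi / cox s t)"
begin

definition fire :: "'s \<Rightarrow> ('s \<Rightarrow> real) \<Rightarrow> 's \<Rightarrow> real" where
  "fire s f = (\<lambda>u. f u + 2 * f s * \<beta> s u)"

lemma fire_self [simp]: "fire s f s = - f s"
  by (simp add: fire_def beta_refl)

lemma fire_fire [simp]: "fire s (fire s f) = f"
  by (rule ext) (simp add: fire_def beta_refl algebra_simps)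

lemma beta_nonneg: "s \<noteq> t \<Longrightarrow> 0 \<le> \<beta> s t"
proof (cases "cox s t = 0")
  case False
  assume "s \<noteq> t"
  have "pi / cox s t \<le> pi / 2"
    using cox_ge2[OF False] by (intro divide_left_mono) auto
  moreover have "- (pi / 2) \<le> pi / cox s t"
    by (rule order_trans[of _ 0]) auto
  ultimately have "0 \<le> cos (pi / cox s t)"
    by (rule cos_ge_zero[rotated])
  then show ?thesis
    using False \<open>s \<noteq> t\<close> by (simp add: beta_fin)
qed (simp add: beta_inf)

section \<open>Alternating firings of a dihedral pair\<close>

fun alt :: "'s \<Rightarrow> 's \<Rightarrow> nat \<Rightarrow> ('s \<Rightarrow> real) \<Rightarrow> 's \<Rightarrow> real" where
  "alt s t 0 f = f"
| "alt s t (Suc k) f = fire (if even k then s else t) (alt s t k f)"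

lemma sin_step: "2 * cos \<theta> * sin x = sin (x + \<theta>) + sin (x - \<theta>)" for x \<theta> :: real
  by (simp add: sin_add sin_diff)

text \<open>The values fired one after the other satisfy v(k+1) = 2 cos \<theta> v(k) - v(k-1),
  which by \<open>sin_step\<close> is the recurrence of \<open>sin (k * \<theta>)\<close>. The first
  conjunct is the value to be fired next, the second the one just fired, with its new sign.\<close>

lemma alt_values:
  fixes \<theta> :: real
  assumes "\<beta> s t = cos \<theta>"
  shows "sin \<theta> * alt s t k f (if even k then s else t)
           = f s * sin ((real k + 1) * \<theta>) + f t * sin (k * \<theta>) \<and>
         sin \<theta> * alt s t k f (if even k then t else s)
           = - (f s * sin (k * \<theta>) + f t * sin ((real k - 1) * \<theta>))"
proof (induction k)
  case 0
  then show ?case by simp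
next
  case (Suc k)
  define c where "c = (if even k then s else t)"
  define d where "d = (if even k then t else s)"
  define g where "g = alt s t k f"
  have b: "\<beta> c d = cos \<theta>"
    using assms beta_sym[of t s] by (auto simp: c_def d_def)
  have IH: "sin \<theta> * g c = f s * sin ((real k + 1) * \<theta>) + f t * sin (k * \<theta>)"
     "sin \<theta> * g d = - (f s * sin (k * \<theta>) + f t * sin ((real k - 1) * \<theta>))"
    using Suc by (simp_all add: c_def d_def g_def)
  have s1: "2 * cos \<theta> * sin ((real k + 1) * \<theta>) = sin ((real k + 2) * \<theta>) + sin (k * \<theta>)"
    using sin_step[of \<theta> "(real k + 1) * \<theta>"] by (simp add: algebra_simps)
  have s2: "2 * cos \<theta> * sin (real k * \<theta>) = sin ((real k + 1) * \<theta>) + sin ((real k - 1) * \<theta>)"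
    using sin_step[of \<theta> "real k * \<theta>"] by (simp add: algebra_simps)
  have "sin \<theta> * fire c g d = sin \<theta> * g d + 2 * cos \<theta> * (sin \<theta> * g c)"
    by (simp add: fire_def b algebra_simps)
  also have "\<dots> = - (f s * sin (k * \<theta>) + f t * sin ((real k - 1) * \<theta>))
      + f s * (2 * cos \<theta> * sin ((real k + 1) * \<theta>)) + f t * (2 * cos \<theta> * sin (k * \<theta>))"
    unfolding IH by (simp add: algebra_simps)
  also have "\<dots> = f s * sin ((real k + 2) * \<theta>) + f t * sin ((real k + 1) * \<theta>)"
    unfolding s1 s2 by (simp add: algebra_simps)
  finally have A: "sin \<theta> * fire c g d = f s * sin ((real k + 2) * \<theta>) + f t * sin ((real k + 1) * \<theta>)" .
  have B: "sin \<theta> * fire c g c = - (f s * sin ((real k + 1) * \<theta>) + f t * sin (k * \<theta>))"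
    using IH by simp
  have "(if even (Suc k) then s else t) = d" "(if even (Suc k) then t else s) = c"
    "alt s t (Suc k) f = fire c g"
    by (auto simp: c_def d_def g_def)
  then show ?case
    using A B by (simp add: add.commute)
qed

lemma sin_prod_diff: "sin (x + y) * sin (x - y) = (sin x)\<^sup>2 - (sin y)\<^sup>2" for x y :: real
proof -
  have "sin (x + y) * sin (x - y) = (sin x)\<^sup>2 * (cos y)\<^sup>2 - (cos x)\<^sup>2 * (sin y)\<^sup>2"
    by (simp add: sin_add sin_diff power2_eq_square algebra_simps)
  also have "\<dots> = (sin x)\<^sup>2 - (sin y)\<^sup>2"
    by (simp add: cos_squared_eq algebra_simps)
  finally show ?thesis .
qed

text \<open>A closed form for the powers of the rotation \<open>s t\<close>; at \<open>n = cox s t\<close> the factor \<open>sin (n \<theta>)\<close>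
vanishes, which gives the Coxeter relation.\<close>

lemma alt_even_formula:
  fixes \<theta> :: real
  assumes "\<beta> s t = cos \<theta>" "sin \<theta> \<noteq> 0"
  shows "(sin \<theta>)\<^sup>2 * (alt s t (2 * n) f u - f u) = 2 * sin (n * \<theta>) *
     ((f s * sin (n * \<theta>) + f t * sin ((real n - 1) * \<theta>)) * \<beta> s u
       + (f s * sin ((real n + 1) * \<theta>) + f t * sin (n * \<theta>)) * \<beta> t u)"
proof (induction n)
  case 0
  then show ?case by simp
next
  case (Suc n)
  define g where "g = alt s t (2 * n) f"
  define h where "h = fire s g"
  have hh: "h = alt s t (Suc (2 * n)) f"
    by (simp add: h_def g_def)
  have v: "sin \<theta> * g s = f s * sin ((2 * real n + 1) * \<theta>) + f t * sin (2 * real n * \<theta>)"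
    using alt_values[OF assms(1), of "2 * n" f] by (simp add: g_def algebra_simps)
  have w: "sin \<theta> * h t = f s * sin ((2 * real n + 2) * \<theta>) + f t * sin ((2 * real n + 1) * \<theta>)"
    using alt_values[OF assms(1), of "Suc (2 * n)" f] unfolding hh by (simp add: algebra_simps)
  \<comment> \<open>The three identities write sines of the large angles as differences of products
    that telescope over the induction.\<close>
  have i1: "sin \<theta> * sin ((2 * real n + 1) * \<theta>) = (sin ((real n + 1) * \<theta>))\<^sup>2 - (sin (n * \<theta>))\<^sup>2"
    using sin_prod_diff[of "(real n + 1) * \<theta>" "real n * \<theta>"] by (simp add: algebra_simps)
  have i2: "sin \<theta> * sin (2 * real n * \<theta>)
      = sin ((real n + 1) * \<theta>) * sin (n * \<theta>) - sin (n * \<theta>) * sin ((real n - 1) * \<theta>)"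
    using sin_double[of "real n * \<theta>"]
    by (simp add: algebra_simps sin_add sin_diff)
  have i3: "sin \<theta> * sin ((2 * real n + 2) * \<theta>)
      = sin ((real n + 1) * \<theta>) * sin ((real n + 2) * \<theta>) - sin (n * \<theta>) * sin ((real n + 1) * \<theta>)"
  proof -
    define y where "y = (real n + 1) * \<theta>"
    have e: "(2 * real n + 2) * \<theta> = 2 * y" "(real n + 2) * \<theta> = y + \<theta>" "real n * \<theta> = y - \<theta>"
      by (simp_all add: y_def algebra_simps)
    show ?thesis
      unfolding e y_def[symmetric] sin_double sin_add sin_diff by (simp add: algebra_simps)
  qed
  have r: "alt s t (2 * Suc n) f u = g u + 2 * g s * \<beta> s u + 2 * h t * \<beta> t u"
    by (simp add: g_def h_def fire_def)
  have "(sin \<theta>)\<^sup>2 * (alt s t (2 * Suc n) f u - f u)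
      = (sin \<theta>)\<^sup>2 * (g u - f u) + 2 * (sin \<theta> * (sin \<theta> * g s)) * \<beta> s u
        + 2 * (sin \<theta> * (sin \<theta> * h t)) * \<beta> t u"
    unfolding r by (simp add: power2_eq_square algebra_simps)
  also have "sin \<theta> * (sin \<theta> * g s) = f s * ((sin ((real n + 1) * \<theta>))\<^sup>2 - (sin (n * \<theta>))\<^sup>2)
      + f t * (sin ((real n + 1) * \<theta>) * sin (n * \<theta>) - sin (n * \<theta>) * sin ((real n - 1) * \<theta>))"
    unfolding v i1[symmetric] i2[symmetric] by (simp add: algebra_simps)
  also have "sin \<theta> * (sin \<theta> * h t)
      = f s * (sin ((real n + 1) * \<theta>) * sin ((real n + 2) * \<theta>) - sin (n * \<theta>) * sin ((real n + 1) * \<theta>))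
      + f t * ((sin ((real n + 1) * \<theta>))\<^sup>2 - (sin (n * \<theta>))\<^sup>2)"
    unfolding w i1[symmetric] i3[symmetric] by (simp add: algebra_simps)
  finally show ?case
    using Suc.IH unfolding g_def
    by (simp add: algebra_simps power2_eq_square)
qed

lemma sin_pi_frac_pos: "2 \<le> p \<Longrightarrow> 0 < k \<Longrightarrow> k < p \<Longrightarrow> 0 < sin (real k * (pi / real p))"
  by (intro sin_gt_zero) (auto simp: field_simps)

lemma alt_period:
  assumes "s \<noteq> t" "cox s t \<noteq> 0"
  shows "alt s t (2 * cox s t) f = f"
proof
  fix u
  let ?\<theta> = "pi / cox s t"
  have b: "\<beta> s t = cos ?\<theta>" using beta_fin assms by blast
  have p: "2 \<le> cox s t" using cox_ge2 assms by blast
  have "sin ?\<theta> > 0" using sin_pi_frac_pos[OF p, of 1] p by simp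
  moreover have "sin (cox s t * ?\<theta>) = 0" using p by simp
  ultimately show "alt s t (2 * cox s t) f u = f u"
    using alt_even_formula[OF b, of "cox s t" f u] by simp
qed

text \<open>Starting with \<open>s\<close> or with \<open>t\<close> runs through the same cycle of
  \<open>2 * cox s t\<close> functionals in opposite directions: \<open>alt_period\<close> closes
  the cycle, and firing twice steps back.\<close>

lemma alt_switch:
  assumes "s \<noteq> t" "cox s t \<noteq> 0" "k \<le> 2 * cox s t"
  shows "alt s t k f = alt t s (2 * cox s t - k) f"
  using assms(3)
proof (induction k)
  case 0
  then show ?case using alt_period[of t s f] assms cox_sym[of s t] by simp
next
  case (Suc k)
  then obtain j where j: "2 * cox s t - k = Suc j" "2 * cox s t - Suc k = j"
    by (metis Suc_diff_Suc Suc_le_lessD)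
  then have "even j \<longleftrightarrow> odd k" using Suc.prems by presburger
  then show ?case using Suc j by auto
qed

text \<open>For \<open>k < cox s t\<close> the angles k \<theta> and (k + 1) \<theta> lie between 0
  and \<pi>, and as \<open>cox s t\<close> is at least 2 their sines do not both vanish. So the
  first \<open>cox s t\<close> firings all lengthen.\<close>

lemma alt_pos:
  assumes "s \<noteq> t" "cox s t \<noteq> 0" "f s > 0" "f t > 0" "k < cox s t"
  shows "alt s t k f (if even k then s else t) > 0"
proof -
  let ?\<theta> = "pi / cox s t"
  have b: "\<beta> s t = cos ?\<theta>" using beta_fin assms by blast
  have p: "2 \<le> cox s t" using cox_ge2 assms by blast
  have s0: "sin ?\<theta> > 0" using sin_pi_frac_pos[OF p, of 1] p by simp
  have nonneg: "0 \<le> sin (real j * ?\<theta>)" if "j \<le> cox s t" for j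
    using that p by (intro sin_ge_zero) (auto simp: field_simps)
  have "0 < sin ((real k + 1) * ?\<theta>) \<or> 0 < sin (k * ?\<theta>)"
  proof (cases "k + 1 = cox s t")
    case True
    then show ?thesis using sin_pi_frac_pos[OF p, of k] p by auto
  next
    case False
    then show ?thesis using sin_pi_frac_pos[OF p, of "k + 1"] assms by (auto simp: algebra_simps)
  qed
  then have "0 < f s * sin ((real k + 1) * ?\<theta>) + f t * sin (k * ?\<theta>)"
    using assms nonneg[of k] nonneg[of "k + 1"]
    by (auto simp: add.commute intro: add_pos_nonneg add_nonneg_pos)
  then have "0 < sin ?\<theta> * alt s t k f (if even k then s else t)"
    using alt_values[OF b, of k f] by (simp add: add.commute)
  then show ?thesis using s0 zero_less_mult_pos by blast
qed

text \<open>After \<open>cox s t\<close> steps the angle has advanced by \<pi>, which reverses the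
  sign. For \<open>f s > 0\<close> this says that the longest element of the dihedral group has been
  reached.\<close>

lemma alt_last:
  assumes "s \<noteq> t" "cox s t \<noteq> 0"
  shows "alt s t (cox s t) f (if even (cox s t) then s else t) = - f s"
proof -
  let ?\<theta> = "pi / cox s t"
  have b: "\<beta> s t = cos ?\<theta>" using beta_fin assms by blast
  have p: "2 \<le> cox s t" using cox_ge2 assms by blast
  have s0: "sin ?\<theta> > 0" using sin_pi_frac_pos[OF p, of 1] p by simp
  have "(real (cox s t) + 1) * ?\<theta> = ?\<theta> + pi"
    using p by (simp add: field_simps)
  then have "sin ((real (cox s t) + 1) * ?\<theta>) = - sin ?\<theta>"
    by (metis sin_periodic_pi)
  moreover have "sin (cox s t * ?\<theta>) = 0" using p by simp
  ultimately have "sin ?\<theta> * alt s t (cox s t) f (if even (cox s t) then s else t) = sin ?\<theta> * (- f s)"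
    using alt_values[OF b, of "cox s t" f] by (simp add: add.commute)
  then show ?thesis using s0 by (metis less_irrefl mult_cancel_left)
qed

text \<open>Starting from the constant functional \<open>1\<close> in the fundamental chamber, firing at positive values
lengthens the group element, so \<open>lev n f\<close> says that \<open>f\<close> belongs to an element of length \<open>n\<close>.\<close>

inductive lev :: "nat \<Rightarrow> ('s \<Rightarrow> real) \<Rightarrow> bool" where
  lev_0: "lev 0 (\<lambda>_. 1)"
| lev_Suc: "lev n f \<Longrightarrow> 0 < f s \<Longrightarrow> lev (Suc n) (fire s f)"

text \<open>The sum is invariant under firing \<open>s\<close> or \<open>t\<close>, because \<beta>
  is 1 on an infinite pair, and firing any other letter at a positive value cannot decrease it.
  Consequently an infinite pair never consists of two descents.\<close>

lemma lev_pair_pos: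
  assumes "lev n f" "s \<noteq> t" "cox s t = 0"
  shows "0 < f s + f t"
  using assms
proof (induction rule: lev.induct)
  case lev_0
  then show ?case by simp
next
  case (lev_Suc n f u)
  consider "u = s" | "u = t" | "u \<noteq> s" "u \<noteq> t" by blast
  then show ?case
  proof cases
    case 3
    then have "0 \<le> f u * \<beta> u s" "0 \<le> f u * \<beta> u t"
      using lev_Suc beta_nonneg by auto
    then show ?thesis using lev_Suc by (simp add: fire_def)
  qed (use lev_Suc beta_inf[of s t] beta_sym[of s t] in \<open>auto simp: fire_def beta_refl\<close>)
qed

lemma lev_alt:
  assumes "s \<noteq> t" "cox s t \<noteq> 0" "lev m u" "0 < u s" "0 < u t" "j \<le> cox s t"
  shows "lev (m + j) (alt s t j u)"
  using assms(6)
proof (induction j)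
  case (Suc j)
  then show ?case
    using alt_pos[OF assms(1,2,4,5), of j] by (simp add: lev_Suc)
qed (use assms in simp)

text \<open>\<open>f\<close> is reached from the minimal representative \<open>u\<close> of its coset modulo the dihedral group of \<open>s, t\<close>
by \<open>j\<close> alternating firings.\<close>

definition dihedral_descent :: "nat \<Rightarrow> ('s \<Rightarrow> real) \<Rightarrow> 's \<Rightarrow> 's \<Rightarrow> nat \<Rightarrow> 's \<Rightarrow> 's \<Rightarrow> ('s \<Rightarrow> real) \<Rightarrow> bool" where
  "dihedral_descent n f s t j a b u \<longleftrightarrow> (a = s \<and> b = t \<or> a = t \<and> b = s) \<and> j \<le> cox s t \<and> j \<le> n \<and>
     lev (n - j) u \<and> 0 < u s \<and> 0 < u t \<and> f = alt a b j u"

text \<open>After at least one step the value just fired is negative, so the positive value at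
  \<open>t\<close> is the next of the alternation, and \<open>alt_last\<close> rules out that the
  longest dihedral element is already reached. For \<open>j = 0\<close> the alternation may start
  with \<open>t\<close>.\<close>

lemma dihedral_descent_step:
  assumes st: "s \<noteq> t" "cox s t \<noteq> 0" and C: "dihedral_descent n g s t j a b u" and gt: "0 < g t"
  shows "\<exists>j a b. dihedral_descent (Suc n) (fire t g) s t (Suc j) a b u \<and> (if even j then a else b) = t"
proof (cases j)
  case 0
  then have "dihedral_descent (Suc n) (fire t g) s t (Suc 0) t s u"
    using C st by (auto simp: dihedral_descent_def)
  then show ?thesis by (intro exI[of _ 0]) auto
next
  case (Suc i)
  have ab: "a \<noteq> b" "cox a b = cox s t" "0 < u a" "0 < u b" "g = alt a b j u" "j \<le> cox s t" "{a,b} = {s,t}"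
    using C st cox_sym[of s t] unfolding dihedral_descent_def by auto
  have "g (if even i then a else b) < 0"
    using alt_pos[of a b u i] ab Suc st by auto
  then have cur: "(if even j then a else b) = t"
    using gt ab(7) Suc by (auto simp: doubleton_eq_iff split: if_splits)
  have "j \<noteq> cox s t"
    using alt_last[of a b u] ab cur gt st by (metis less_asym neg_less_0_iff_less)
  then have "dihedral_descent (Suc n) (fire t g) s t (Suc j) a b u"
    using C cur by (auto simp: dihedral_descent_def)
  with cur show ?thesis by blast
qed

text \<open>The exchange property for a dihedral pair: after an alternation ending in
  \<open>t\<close>, the letter \<open>s\<close> is a descent only at the longest element, and there
  \<open>alt_switch\<close> provides a second path of the same length that ends in
  \<open>s\<close>.\<close>

lemma dihedral_descent_last:
  assumes st: "s \<noteq> t" "cox s t \<noteq> 0" and C: "dihedral_descent (Suc n) f s t (Suc j) a b u"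
    and t: "(if even j then a else b) = t"
  shows "f s \<noteq> 0 \<and> (f s < 0 \<longrightarrow> lev n (fire s f))"
proof -
  have ab: "a \<noteq> b" "cox a b = cox s t" "cox b a = cox s t" "0 < u a" "0 < u b"
    "f = alt a b (Suc j) u" "Suc j \<le> cox s t" "{a,b} = {s,t}" "lev (n - j) u" "j \<le> n"
    using C st cox_sym[of s t] unfolding dihedral_descent_def by auto
  have s: "(if even (Suc j) then a else b) = s"
    using ab(8) t st by (auto simp: doubleton_eq_iff split: if_splits)
  show ?thesis
  proof (cases "Suc j = cox s t")
    case True
    have "f s < 0"
      using alt_last[of a b u] ab s True st by (metis neg_less_0_iff_less)
    moreover have "f = alt b a (Suc j) u"
      using alt_switch[of a b "Suc j" u] ab True st by simp
    then have "fire s f = alt b a j u"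
      using s by auto
    moreover have "lev (n - j + j) (alt b a j u)"
      using ab True st by (intro lev_alt) auto
    ultimately show ?thesis using ab by auto
  next
    case False
    then have "0 < f s"
      using alt_pos[of a b u "Suc j"] ab s st by (metis le_neq_implies_less)
    then show ?thesis by auto
  qed
qed

text \<open>Tits's theorem that signs detect descents, proved together with the dihedral
  decomposition. For a letter \<open>v\<close> and the last fired letter \<open>t0\<close>, an
  infinite pair is settled by \<open>lev_pair_pos\<close>; for a finite pair the predecessor
  \<open>g\<close> is decomposed modulo the pair. To decompose \<open>f\<close> itself, fire a
  negative value at \<open>s\<close> or \<open>t\<close> and use the hypothesis; if both values are
  positive, \<open>f\<close> is already minimal.\<close>

lemma lev_descent:
  "lev n f \<Longrightarrow> f s \<noteq> 0 \<and> (f s < 0 \<longrightarrow> 0 < n \<and> lev (n - 1) (fire s f)) \<and>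
    (s \<noteq> t \<longrightarrow> cox s t \<noteq> 0 \<longrightarrow> (\<exists>j a b u. dihedral_descent n f s t j a b u))"
proof (induction n arbitrary: f s t)
  case 0
  then have "f = (\<lambda>_. 1)" using lev.cases by blast
  then have "dihedral_descent 0 f s t 0 s t f"
    using 0 by (simp add: dihedral_descent_def)
  then show ?case using \<open>f = _\<close> by auto
next
  case (Suc n)
  obtain g t0 where g: "lev n g" "0 < g t0" "f = fire t0 g"
    using Suc.prems by (cases rule: lev.cases) auto
  have down: "f v \<noteq> 0 \<and> (f v < 0 \<longrightarrow> lev n (fire v f))" for v
  proof (cases "v = t0")
    case True
    then show ?thesis using g by simp
  next
    case False
    show ?thesis
    proof (cases "cox v t0 = 0")
      case True
      then show ?thesis using lev_pair_pos[OF Suc.prems False True] g by auto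
    next
      case fin: False
      obtain j a b u where "dihedral_descent n g v t0 j a b u"
        using Suc.IH[OF g(1), of v t0] False fin by blast
      from dihedral_descent_step[OF False fin this g(2)] obtain i a b where
        "dihedral_descent (Suc n) f v t0 (Suc i) a b u" "(if even i then a else b) = t0"
        using g(3) by blast
      from dihedral_descent_last[OF False fin this] show ?thesis .
    qed
  qed
  have "\<exists>j a b u. dihedral_descent (Suc n) f s t j a b u" if st: "s \<noteq> t" "cox s t \<noteq> 0"
  proof -
    have flip: "dihedral_descent m f' s t j a b u" if "dihedral_descent m f' t s j a b u" for m f' j a b u
      using that cox_sym[of s t] by (auto simp: dihedral_descent_def)
    have *: "\<exists>j a b u. dihedral_descent (Suc n) f s' t' j a b u"
      if neg: "f t' < 0" and st: "s' \<noteq> t'" "cox s' t' \<noteq> 0" for s' t'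
    proof -
      have "lev n (fire t' f)" using down neg by blast
      then obtain j a b u where "dihedral_descent n (fire t' f) s' t' j a b u"
        using Suc.IH st by blast
      from dihedral_descent_step[OF st this] show ?thesis using neg by auto
    qed
    consider "f t < 0" | "f s < 0" | "0 < f s" "0 < f t"
      using down by (meson linorder_neqE_linordered_idom)
    then show ?thesis
    proof cases
      case 2
      then show ?thesis using *[of s t] st flip cox_sym[of s t] by metis
    next
      case 3
      then have "dihedral_descent (Suc n) f s t 0 s t f" using Suc.prems by (simp add: dihedral_descent_def)
      then show ?thesis by blast
    qed (use * st in blast)
  qed
  then show ?case using down by auto
qed

lemma lev_nonzero: "lev n f \<Longrightarrow> f s \<noteq> 0"
  using lev_descent by blast

lemma lev_down:
  assumes "lev n f" "f s < 0"
  obtains m where "n = Suc m" "lev m (fire s f)"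
  using lev_descent[of n f s s] assms by (metis Suc_pred')

lemma lev_unique: "lev n f \<Longrightarrow> lev m f \<Longrightarrow> m = n"
proof (induction arbitrary: m rule: lev.induct)
  case lev_0
  show ?case
  proof (rule ccontr)
    assume "m \<noteq> 0"
    then obtain k g s where "(\<lambda>_. 1) = fire s g" "0 < g s"
      using lev_0 by (auto elim: lev.cases)
    then show False by (metis fire_self neg_less_0_iff_less not_one_less_zero)
  qed
next
  case (lev_Suc n f s)
  have "fire s f s < 0" using lev_Suc by simp
  then obtain k where "m = Suc k" "lev k (fire s (fire s f))"
    using lev_down lev_Suc.prems by blast
  then show ?case using lev_Suc.IH by simp
qed

end

section \<open>Bipartite games and the absence of infinite zigzags\<close>

locale bipartite_game = numbers_game +
  fixes side :: "'a \<Rightarrow> bool"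
  assumes same_side: "s \<noteq> t \<Longrightarrow> side s = side t \<Longrightarrow> cox s t = 0"
begin

lemma not_both_neg: "lev n f \<Longrightarrow> f s < 0 \<Longrightarrow> f t < 0 \<Longrightarrow> side s = side t \<Longrightarrow> s = t"
  using lev_pair_pos[of n f s t] same_side[of s t] by force

lemma fire_neg: "s \<noteq> t \<Longrightarrow> f s < 0 \<Longrightarrow> f t < 0 \<Longrightarrow> fire s f t < 0"
  using beta_nonneg[of s t] mult_nonpos_nonneg[of "f s" "\<beta> s t"] by (simp add: fire_def)

text \<open>The dihedral group has a longest element of length at least 3, so two descents leave
  room for a third. Numerically \<beta> is at least 1/2, which makes the coefficient 4 \<beta>^2 - 1
  of \<open>f s\<close> nonnegative.\<close>

lemma fire_fire_neg:
  assumes "s \<noteq> t" "3 \<le> cox s t" "f s < 0" "f t < 0"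
  shows "fire t (fire s f) s < 0"
proof -
  have "cos (pi / 3) \<le> cos (pi / cox s t)"
    using assms by (intro cos_monotone_0_pi_le divide_left_mono) (auto simp: field_simps)
  then have b: "1 / 2 \<le> \<beta> s t"
    using assms beta_fin[of s t] by (simp add: cos_60)
  then have "1 \<le> 4 * (\<beta> s t * \<beta> s t)"
    using mult_mono[of "1/2" "\<beta> s t" "1/2" "\<beta> s t"] by simp
  then have "f s * (4 * (\<beta> s t * \<beta> s t) - 1) \<le> 0" "f t * \<beta> s t < 0"
    using assms b by (auto simp: mult_le_0_iff mult_less_0_iff)
  moreover have "fire t (fire s f) s = f s * (4 * (\<beta> s t * \<beta> s t) - 1) + 2 * (f t * \<beta> s t)"
    using beta_sym[of t s] by (simp add: fire_def beta_refl algebra_simps)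
  ultimately show ?thesis by linarith
qed

text \<open>A zigzag runs forever between two consecutive levels: from \<open>c k\<close> it climbs by \<open>b k\<close> and descends by
\<open>a (Suc k)\<close>. Every peak and every valley then has two descents, which forces \<open>cox (a (Suc k)) (b k) = 2\<close>;
completing the resulting squares downwards gives a zigzag one level below.\<close>

lemma no_zigzag:
  assumes "\<And>k. lev n (c k)" "\<And>k. 0 < c k (a k)" "\<And>k. 0 < c k (b k)"
    "\<And>k. \<not> side (a k)" "\<And>k. side (b k)"
    "\<And>k. fire (b k) (c k) = fire (a (Suc k)) (c (Suc k))"
  shows False
  using assms
proof (induction n arbitrary: a b c)
  case 0
  have c: "c k = (\<lambda>_. 1)" for k
    using "0.prems"(1)[of k] by (auto elim: lev.cases)
  have ne: "a 1 \<noteq> b 0" using "0.prems"(4,5) by metis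
  \<comment> \<open>Firing \<open>b 0\<close> leaves -1 at \<open>b 0\<close>, whereas firing
    \<open>a 1\<close> leaves at least 1 there.\<close>
  have "fire (b 0) (c 0) (b 0) = fire (a 1) (c 1) (b 0)"
    using "0.prems"(6)[of 0] by simp
  then show False
    using beta_nonneg[OF ne] by (simp add: c fire_def beta_refl)
next
  case (Suc n)
  have ne: "a i \<noteq> b k" for i k using Suc.prems(4,5) by metis
  \<comment> \<open>The peak above \<open>c (Suc k)\<close> has the descents
    \<open>b (Suc k)\<close> and \<open>a (Suc (Suc k))\<close>; going down through the first keeps
    the second.\<close>
  have neg1: "c (Suc k) (a (Suc (Suc k))) < 0" for k
  proof -
    let ?h = "fire (b (Suc k)) (c (Suc k))"
    have "?h (b (Suc k)) < 0" using Suc.prems(3) by simp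
    moreover have "?h (a (Suc (Suc k))) < 0" using Suc.prems(2,6) by simp
    ultimately show ?thesis using fire_neg[of "b (Suc k)" "a (Suc (Suc k))" ?h] ne[of "Suc (Suc k)" "Suc k"] by simp
  qed
  have key: "lev n (fire (b k) (c (Suc k))) \<and> fire (b k) (c (Suc k)) = fire (a (Suc k)) (c k) \<and>
    0 < fire (b k) (c (Suc k)) (a (Suc k)) \<and> 0 < fire (b k) (c (Suc k)) (b k)" for k
  proof -
    define A where "A = a (Suc k)"
    define B where "B = b k"
    define h where "h = fire B (c k)"
    define D where "D = fire B (c (Suc k))"
    have AB: "A \<noteq> B" using ne by (simp add: A_def B_def)
    have hA: "h = fire A (c (Suc k))" using Suc.prems(6) by (simp add: h_def A_def B_def)
    have "h A < 0"
      using Suc.prems(2)[of "Suc k"] by (simp add: hA A_def)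
    moreover have "h B < 0"
      using Suc.prems(3)[of k] by (simp add: h_def B_def)
    ultimately have neg: "h A < 0" "h B < 0" by blast+
    have c1: "c (Suc k) = fire A h" using hA by simp
    have c0: "c k = fire B h" by (simp add: h_def)
    have c1B: "c (Suc k) B < 0" using fire_neg[OF AB neg] c1 by simp
    have c0A: "c k A < 0" using fire_neg[of B A h] neg AB c0 by simp
    have levD: "lev n D"
      using lev_down[OF Suc.prems(1)[of "Suc k"] c1B] by (auto simp: D_def)
    have "lev (Suc (Suc n)) h"
      using lev_Suc[OF Suc.prems(1)[of k] Suc.prems(3)] by (simp add: h_def B_def)
    then have "cox A B \<noteq> 0"
      using lev_pair_pos[of "Suc (Suc n)" h A B] AB neg by auto
    \<comment> \<open>Otherwise \<open>A\<close> and \<open>a (Suc (Suc k))\<close> would both be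
      descents of \<open>D\<close> off the side, hence equal; but at \<open>c (Suc k)\<close> the
      first has a positive value and the second a negative one.\<close>
    moreover have "\<not> 3 \<le> cox A B"
    proof
      assume "3 \<le> cox A B"
      then have "D A < 0" using fire_fire_neg[OF AB _ neg] c1 by (simp add: D_def)
      moreover have "D (a (Suc (Suc k))) < 0"
        using fire_neg[of B "a (Suc (Suc k))" "c (Suc k)"] c1B neg1 ne by (metis B_def D_def)
      ultimately have "A = a (Suc (Suc k))"
        using not_both_neg[OF levD] Suc.prems(4) A_def by simp
      then show False using neg1[of k] Suc.prems(2)[of "Suc k"] by (simp add: A_def)
    qed
    ultimately have "cox A B = 2" using cox_ge2[of A B] by simp
    then have "\<beta> A B = 0" using beta_fin[OF AB] by simp
    then have "\<beta> B A = 0" using beta_sym by metis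
    \<comment> \<open>Orthogonal reflections commute, so the square with top \<open>h\<close> and
      bottom \<open>D\<close> closes.\<close>
    have "D = fire A (c k)"
      using \<open>\<beta> A B = 0\<close> \<open>\<beta> B A = 0\<close> by (simp add: D_def c0 c1) (simp add: fire_def fun_eq_iff)
    moreover have "0 < D B" using c1B by (simp add: D_def)
    ultimately show ?thesis
      using levD c0A by (simp add: D_def[symmetric] A_def[symmetric] B_def[symmetric])
  qed
  show False
  proof (rule Suc.IH[of "\<lambda>k. fire (b k) (c (Suc k))" "\<lambda>k. a (Suc k)" b])
    fix k
    show "lev n (fire (b k) (c (Suc k)))" "0 < fire (b k) (c (Suc k)) (a (Suc k))"
      "0 < fire (b k) (c (Suc k)) (b k)" using key by blast+
    show "\<not> side (a (Suc k))" "side (b k)" using Suc.prems by blast+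
    have "fire (b k) (fire (b k) (c (Suc k))) = c (Suc k)" by simp
    also have "\<dots> = fire (a (Suc (Suc k))) (fire (b (Suc k)) (c (Suc (Suc k))))"
      using key[of "Suc k"] by simp
    finally show "fire (b k) (fire (b k) (c (Suc k)))
      = fire (a (Suc (Suc k))) (fire (b (Suc k)) (c (Suc (Suc k))))" .
  qed
qed

text \<open>Two peaks over a common valley \<open>c\<close>. The orientation is essential: the
  smaller one is reached through a letter of the side, the larger one through a letter off
  it.\<close>

definition zigzag :: "(('a \<Rightarrow> real) \<times> ('a \<Rightarrow> real)) set" where
  "zigzag = {(fire b c, fire a c) | a b c. (\<exists>n. lev n c) \<and> 0 < c a \<and> 0 < c b \<and> \<not> side a \<and> side b}"

text \<open>Consecutive valleys of a descending chain lie one level below a common peak, so by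
  \<open>lev_unique\<close> all valleys have the same level and \<open>no_zigzag\<close>
  applies.\<close>

lemma wf_zigzag: "wf zigzag"
  unfolding wf_iff_no_infinite_down_chain
proof
  assume "\<exists>h. \<forall>k. (h (Suc k), h k) \<in> zigzag"
  then obtain h where h: "\<And>k. (h (Suc k), h k) \<in> zigzag" by blast
  have "\<forall>k. \<exists>a b c n. h (Suc k) = fire b c \<and> h k = fire a c \<and> lev n c \<and> 0 < c a \<and> 0 < c b \<and>
      \<not> side a \<and> side b"
    using h unfolding zigzag_def by blast
  then obtain a b c n where *: "\<And>k. h (Suc k) = fire (b k) (c k)" "\<And>k. h k = fire (a k) (c k)"
    "\<And>k. lev (n k) (c k)" "\<And>k. 0 < c k (a k)" "\<And>k. 0 < c k (b k)"
    "\<And>k. \<not> side (a k)" "\<And>k. side (b k)"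
    by metis
  have "n (Suc k) = n k" for k
    using lev_Suc[OF *(3,4), of "Suc k"] lev_Suc[OF *(3,5), of k] *(1)[of k] *(2)[of "Suc k"]
      lev_unique by fastforce
  then have "n k = n 0" for k by (induction k) auto
  then show False
    using no_zigzag[of "n 0" c a b] * by metis
qed

end

subsection \<open>Lengths in large even Artin groups\<close>

text \<open>The product is composition in reverse order, so that homomorphisms into this group are right actions.\<close>

definition perm_group :: "('a \<Rightarrow> 'a) monoid" where
  "perm_group = \<lparr>carrier = {f. bij f}, monoid.mult = (\<lambda>f g. g \<circ> f), monoid.one = id\<rparr>"

lemma perm_group_simps [simp]:
  "carrier perm_group = {f. bij f}" "f \<otimes>\<^bsub>perm_group\<^esub> g = g \<circ> f" "\<one>\<^bsub>perm_group\<^esub> = id"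
  by (simp_all add: perm_group_def)

lemma perm_group_group: "group perm_group"
proof (rule groupI)
  fix f :: "'a \<Rightarrow> 'a" assume "f \<in> carrier perm_group"
  then show "\<exists>g\<in>carrier perm_group. g \<otimes>\<^bsub>perm_group\<^esub> f = \<one>\<^bsub>perm_group\<^esub>"
    by (intro bexI[of _ "inv_into UNIV f"]) (auto simp: bij_imp_bij_inv bij_is_surj fun_eq_iff surj_f_inv_f)
qed (auto simp: bij_comp)

lemma perm_group_pow: "f [^]\<^bsub>perm_group\<^esub> (n::nat) = f ^^ n"
  by (induction n) simp_all

locale large_even_graph = even_graph +
  assumes large: "large_artin E m"
begin

lemma half_ge_2: "e \<in> E \<Longrightarrow> 2 \<le> half e"
  using large label[of e] by (fastforce simp: large_artin_def)

text \<open>Each generator \<open>x\<close> has two reflections \<open>(False, x)\<close> and \<open>(True, x)\<close>. Twisting by the swap of the two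
copies makes \<open>x y\<close> act as the product of \<open>(False, x)\<close> and \<open>(True, y)\<close>, of order \<open>half {x, y}\<close>. So both sides of
the Artin relation act trivially, while \<open>x\<close> itself acts with infinite order.\<close>

definition cox :: "bool \<times> 'a \<Rightarrow> bool \<times> 'a \<Rightarrow> nat" where
  "cox s t = (if fst s \<noteq> fst t \<and> {snd s, snd t} \<in> E then half {snd s, snd t} else 0)"

definition beta :: "bool \<times> 'a \<Rightarrow> bool \<times> 'a \<Rightarrow> real" where
  "beta s t = (if s = t then - 1 else if cox s t = 0 then 1 else cos (pi / cox s t))"

lemma cox_commute: "cox s t = cox t s"
  by (simp add: cox_def insert_commute)

sublocale game: bipartite_game beta cox fst
proof
  show "beta s t = beta t s" for s t
    using cox_commute[of s t] by (auto simp: beta_def)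
  show "2 \<le> cox s t" if "cox s t \<noteq> 0" for s t
    using that half_ge_2 by (auto simp: cox_def split: if_splits)
qed (auto simp: beta_def cox_commute, auto simp: cox_def)

definition swap :: "(bool \<times> 'a \<Rightarrow> real) \<Rightarrow> bool \<times> 'a \<Rightarrow> real" where
  "swap f = (\<lambda>(b, x). f (\<not> b, x))"

lemma swap_apply [simp]: "swap f (b, x) = f (\<not> b, x)"
  by (simp add: swap_def)

lemma swap_swap [simp]: "swap (swap f) = f"
  by (simp add: swap_def fun_eq_iff)

lemma swap_fire: "swap (game.fire (b, x) f) = game.fire (\<not> b, x) (swap f)"
proof -
  have "beta (b, x) (\<not> c, y) = beta (\<not> b, x) (c, y)" for c y
    by (auto simp: beta_def cox_def)
  then show ?thesis by (auto simp: fun_eq_iff game.fire_def)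
qed

definition act :: "'a \<Rightarrow> (bool \<times> 'a \<Rightarrow> real) \<Rightarrow> bool \<times> 'a \<Rightarrow> real" where
  "act x f = swap (game.fire (False, x) f)"

lemma bij_act: "bij (act x)"
  by (rule o_bij[of "\<lambda>f. game.fire (False, x) (swap f)"]) (auto simp: act_def)

lemma act_act: "act y (act x f) = game.fire (True, y) (game.fire (False, x) f)"
  by (simp add: act_def swap_fire)

lemma act_relation:
  assumes "{x, y} \<in> E"
  shows "((act y \<circ> act x) ^^ half {x, y}) f = f"
proof -
  have "((act y \<circ> act x) ^^ n) f = game.alt (False, x) (True, y) (2 * n) f" for n
    by (induction n) (simp_all add: act_act)
  moreover have "cox (False, x) (True, y) = half {x, y}"
    using assms by (simp add: cox_def)
  ultimately show ?thesis
    using game.alt_period[of "(False, x)" "(True, y)" f] half_ge_2[OF assms] by simp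
qed

lemma ex_num_act: "\<exists>h. h \<in> hom A perm_group \<and> (\<forall>v\<in>V. h (gen v) = act v)"
proof -
  obtain h where "h \<in> hom A perm_group" "\<And>v. v \<in> V \<Longrightarrow> h (gen v) = act v"
  proof (rule universal[of perm_group act])
    fix u v assume "{u, v} \<in> E"
    then show "(act u \<otimes>\<^bsub>perm_group\<^esub> act v) [^]\<^bsub>perm_group\<^esub> half {u, v}
        = (act v \<otimes>\<^bsub>perm_group\<^esub> act u) [^]\<^bsub>perm_group\<^esub> half {u, v}"
      using act_relation[of u v] act_relation[of v u]
      by (simp add: perm_group_pow fun_eq_iff insert_commute)
  qed (simp_all add: perm_group_group bij_act)
  then show ?thesis by blast
qed

definition num_act where "num_act = (SOME h. h \<in> hom A perm_group \<and> (\<forall>v\<in>V. h (gen v) = act v))"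

text \<open>Only the orbit of the constant functional matters: length and descents are read off from
  it, although distinct elements of \<open>A\<close> may share their \<open>num\<close>.\<close>

definition num :: "'a word set \<Rightarrow> bool \<times> 'a \<Rightarrow> real" where
  "num g = num_act g (\<lambda>_. 1)"

lemma num_act: "group_hom A perm_group num_act" "v \<in> V \<Longrightarrow> num_act (gen v) = act v"
  using someI_ex[OF ex_num_act] is_group perm_group_group
  by (auto simp: group_hom_def group_hom_axioms_def num_act_def)

lemma num_one: "num \<one>\<^bsub>A\<^esub> = (\<lambda>_. 1)"
  using group_hom.hom_one[OF num_act(1)] by (simp add: num_def)

lemma num_gen: "g \<in> carrier A \<Longrightarrow> v \<in> V \<Longrightarrow> num (g \<otimes>\<^bsub>A\<^esub> gen v) = act v (num g)"
  using group_hom.hom_mult[OF num_act(1)] num_act(2) by (simp add: num_def gen_closed)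

text \<open>\<open>act v\<close> fires \<open>(False, v)\<close> and then swaps the copies, so
  undoing it means firing \<open>(True, v)\<close> and then swapping. Hence the sign at
  \<open>(False, v)\<close> governs multiplication by \<open>gen v\<close>, and the sign at
  \<open>(True, v)\<close> multiplication by its inverse.\<close>

lemma num_inv_gen:
  assumes "g \<in> carrier A" "v \<in> V"
  shows "num (g \<otimes>\<^bsub>A\<^esub> inv\<^bsub>A\<^esub> gen v) = swap (game.fire (True, v) (num g))"
proof -
  have "act v (num (g \<otimes>\<^bsub>A\<^esub> inv\<^bsub>A\<^esub> gen v)) = num g"
    using num_gen[of "g \<otimes>\<^bsub>A\<^esub> inv\<^bsub>A\<^esub> gen v" v] assms gen_closed[of v] by (simp add: m_assoc)
  also have "num g = act v (swap (game.fire (True, v) (num g)))"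
    by (simp add: act_def swap_fire)
  finally show ?thesis using bij_act[of v] by (metis bij_pointE)
qed

lemma lev_swap: "game.lev n f \<Longrightarrow> game.lev n (swap f)"
proof (induction rule: game.lev.induct)
  case lev_0
  have "swap (\<lambda>_. 1) = (\<lambda>_. 1)" by (simp add: fun_eq_iff)
  then show ?case using game.lev_0 by simp
next
  case (lev_Suc n f s)
  then show ?case
    using game.lev_Suc[of n "swap f" "(\<not> fst s, snd s)"] swap_fire[of "fst s" "snd s" f] by simp
qed

lemma lev_fire: "game.lev n f \<Longrightarrow> \<exists>k. game.lev k (game.fire s f)"
  using game.lev_Suc[of n f s] game.lev_down[of n f s] game.lev_nonzero[of n f s]
  by (metis linorder_neqE_linordered_idom)

lemma ex_lev_num: "g \<in> carrier A \<Longrightarrow> \<exists>n. game.lev n (num g)"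
proof (induction rule: gen_induct)
  case one
  then show ?case using game.lev_0 num_one by auto
next
  case (gen g v)
  then have "num (g \<otimes>\<^bsub>A\<^esub> gen v) = swap (game.fire (False, v) (num g))"
    by (simp add: num_gen act_def)
  then show ?case using gen lev_fire lev_swap by metis
next
  case (inv_gen g v)
  then have "num (g \<otimes>\<^bsub>A\<^esub> inv\<^bsub>A\<^esub> gen v) = swap (game.fire (True, v) (num g))"
    by (simp add: num_inv_gen)
  then show ?case using inv_gen lev_fire lev_swap by metis
qed

definition level :: "'a word set \<Rightarrow> nat" where
  "level g = (THE n. game.lev n (num g))"

lemma level_eq: "game.lev n (num g) \<Longrightarrow> level g = n"
  unfolding level_def using game.lev_unique by blast

lemma lev_level: "g \<in> carrier A \<Longrightarrow> game.lev (level g) (num g)"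
  using ex_lev_num level_eq by fastforce

lemma num_nonzero: "g \<in> carrier A \<Longrightarrow> num g s \<noteq> 0"
  using game.lev_nonzero lev_level by blast

lemma num_not_both_neg:
  "g \<in> carrier A \<Longrightarrow> num g (b, x) < 0 \<Longrightarrow> num g (b, y) < 0 \<Longrightarrow> x = y"
  using game.not_both_neg[OF lev_level, of g "(b, x)" "(b, y)"] by simp

text \<open>There are no loops, so the two copies of \<open>x\<close> form an infinite pair. Thus
  \<open>gen x\<close> and its inverse never both shorten.\<close>

lemma num_opposite:
  assumes "g \<in> carrier A" "x \<in> V"
  shows "0 < num g (False, x) + num g (True, x)"
proof -
  have "cox (False, x) (True, x) = 0"
    using edge_vertices[of x x] by (auto simp: cox_def)
  then show ?thesis
    using game.lev_pair_pos[OF lev_level[OF assms(1)], of "(False, x)" "(True, x)"] by simp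
qed

lemma num_gen_True:
  "g \<in> carrier A \<Longrightarrow> x \<in> V \<Longrightarrow> num (g \<otimes>\<^bsub>A\<^esub> gen x) (True, x) = - num g (False, x)"
  by (simp add: num_gen act_def)

lemma level_up:
  assumes "g \<in> carrier A" "x \<in> V" "0 < num g (False, x)"
  shows "level (g \<otimes>\<^bsub>A\<^esub> gen x) = Suc (level g)"
  using lev_swap[OF game.lev_Suc[OF lev_level[OF assms(1)] assms(3)]] num_gen[OF assms(1,2)]
  by (intro level_eq) (simp add: act_def)

lemma level_down:
  assumes "g \<in> carrier A" "x \<in> V" "num g (False, x) < 0"
  shows "level g = Suc (level (g \<otimes>\<^bsub>A\<^esub> gen x))"
proof -
  obtain k where k: "level g = Suc k" "game.lev k (game.fire (False, x) (num g))"
    using game.lev_down[OF lev_level[OF assms(1)] assms(3)] .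
  have "level (g \<otimes>\<^bsub>A\<^esub> gen x) = k"
    using lev_swap[OF k(2)] num_gen[OF assms(1,2)] by (intro level_eq) (simp add: act_def)
  then show ?thesis using k by simp
qed

definition gpow :: "'a \<Rightarrow> int \<Rightarrow> 'a word set" where
  "gpow x i = gen x [^]\<^bsub>A\<^esub> i"

lemma gpow_closed [simp]: "x \<in> V \<Longrightarrow> gpow x i \<in> carrier A"
  by (simp add: gpow_def gen_closed)

lemma gpow_add: "x \<in> V \<Longrightarrow> gpow x i \<otimes>\<^bsub>A\<^esub> gpow x j = gpow x (i + j)"
  by (simp add: gpow_def gen_closed int_pow_mult)

lemma gpow_0 [simp]: "gpow x 0 = \<one>\<^bsub>A\<^esub>"
  by (simp add: gpow_def)

lemma gpow_1 [simp]: "x \<in> V \<Longrightarrow> gpow x 1 = gen x"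
  by (simp add: gpow_def gen_closed)

lemma mult_gpow_gpow: "g \<in> carrier A \<Longrightarrow> x \<in> V \<Longrightarrow> g \<otimes>\<^bsub>A\<^esub> gpow x i \<otimes>\<^bsub>A\<^esub> gpow x j = g \<otimes>\<^bsub>A\<^esub> gpow x (i + j)"
  by (simp add: m_assoc gpow_add)

lemma mult_gpow_gen: "g \<in> carrier A \<Longrightarrow> x \<in> V \<Longrightarrow> g \<otimes>\<^bsub>A\<^esub> gpow x i \<otimes>\<^bsub>A\<^esub> gen x = g \<otimes>\<^bsub>A\<^esub> gpow x (i + 1)"
  using mult_gpow_gpow[of g x i 1] by simp

text \<open>\<open>b\<close> is the shortest element of its coset modulo the powers of \<open>gen x\<close>. Negativity of \<open>num g (False, x)\<close>
or \<open>num g (True, x)\<close> means that multiplication by \<open>gen x\<close> or its inverse shortens \<open>g\<close>.\<close>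

definition line :: "'a \<Rightarrow> 'a word set \<Rightarrow> bool" where
  "line x b \<longleftrightarrow> b \<in> carrier A \<and> (\<forall>i. (num (b \<otimes>\<^bsub>A\<^esub> gpow x i) (False, x) < 0 \<longleftrightarrow> i < 0) \<and>
     (num (b \<otimes>\<^bsub>A\<^esub> gpow x i) (True, x) < 0 \<longleftrightarrow> 0 < i) \<and> level (b \<otimes>\<^bsub>A\<^esub> gpow x i) = level b + nat \<bar>i\<bar>)"

text \<open>Take a position of minimal level, from which neither direction shortens. After a
  lengthening step the way back shortens, so by \<open>num_opposite\<close> the next step in the
  same direction lengthens again, and this continues forever.\<close>

lemma line_exists:
  assumes g: "g \<in> carrier A" and x: "x \<in> V"
  obtains b j where "line x b" "g = b \<otimes>\<^bsub>A\<^esub> gpow x j"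
proof -
  obtain i0 where i0: "\<And>i. level (g \<otimes>\<^bsub>A\<^esub> gpow x i0) \<le> level (g \<otimes>\<^bsub>A\<^esub> gpow x i)"
    using ex_has_least_nat[of "\<lambda>_. True" "0::int" "\<lambda>i. level (g \<otimes>\<^bsub>A\<^esub> gpow x i)"] by auto
  define b where "b = g \<otimes>\<^bsub>A\<^esub> gpow x i0"
  have b: "b \<in> carrier A" using g x by (simp add: b_def)
  have min: "level b \<le> level (b \<otimes>\<^bsub>A\<^esub> gpow x i)" for i
    using i0 g x by (simp add: b_def mult_gpow_gpow)
  have next_gpow: "b \<otimes>\<^bsub>A\<^esub> gpow x (i + 1) = b \<otimes>\<^bsub>A\<^esub> gpow x i \<otimes>\<^bsub>A\<^esub> gen x" for i
    using b x mult_gpow_gen by simp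
  have c: "b \<otimes>\<^bsub>A\<^esub> gpow x i \<in> carrier A" for i using b x by simp
  have opp: "num (b \<otimes>\<^bsub>A\<^esub> gpow x i) (False, x) < 0 \<Longrightarrow> 0 < num (b \<otimes>\<^bsub>A\<^esub> gpow x i) (True, x)"
     "num (b \<otimes>\<^bsub>A\<^esub> gpow x i) (True, x) < 0 \<Longrightarrow> 0 < num (b \<otimes>\<^bsub>A\<^esub> gpow x i) (False, x)" for i
    using num_opposite[OF c x, of i] by linarith+
  have pos: "num (b \<otimes>\<^bsub>A\<^esub> gpow x (int n)) (False, x) > 0 \<and>
      (num (b \<otimes>\<^bsub>A\<^esub> gpow x (int n)) (True, x) < 0 \<longleftrightarrow> 0 < n) \<and> level (b \<otimes>\<^bsub>A\<^esub> gpow x (int n)) = level b + n" for n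
  proof (induction n)
    case 0
    have "\<not> num b (False, x) < 0"
      using level_down[OF b x] min[of 1] x by fastforce
    moreover have "\<not> num b (True, x) < 0"
    proof
      assume "num b (True, x) < 0"
      moreover have bb: "b \<otimes>\<^bsub>A\<^esub> gpow x (-1) \<otimes>\<^bsub>A\<^esub> gen x = b" using next_gpow[of "-1"] b by simp
      ultimately have "0 < num (b \<otimes>\<^bsub>A\<^esub> gpow x (-1)) (False, x)"
        using num_gen_True[OF c x, of "-1"] by simp
      then show False using level_up[OF c x, of "-1"] min[of "-1"] bb by simp
    qed
    ultimately show ?case
      using b num_nonzero[OF b, of "(False, x)"] by auto
  next
    case (Suc n)
    have e: "b \<otimes>\<^bsub>A\<^esub> gpow x (int (Suc n)) = b \<otimes>\<^bsub>A\<^esub> gpow x (int n) \<otimes>\<^bsub>A\<^esub> gen x"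
      using next_gpow[of "int n"] by (simp add: add.commute)
    have t: "num (b \<otimes>\<^bsub>A\<^esub> gpow x (int (Suc n))) (True, x) < 0"
      unfolding e num_gen_True[OF c x] using Suc by simp
    moreover have "level (b \<otimes>\<^bsub>A\<^esub> gpow x (int (Suc n))) = Suc (level b + n)"
      unfolding e using level_up[OF c x] Suc by simp
    ultimately show ?case using opp(2) by auto
  qed
  have neg: "num (b \<otimes>\<^bsub>A\<^esub> gpow x (- int n)) (True, x) > 0 \<and>
      (num (b \<otimes>\<^bsub>A\<^esub> gpow x (- int n)) (False, x) < 0 \<longleftrightarrow> 0 < n) \<and> level (b \<otimes>\<^bsub>A\<^esub> gpow x (- int n)) = level b + n" for n
  proof (induction n)
    case 0
    then show ?case using pos[of 0] b num_nonzero[OF b, of "(True, x)"] by auto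
  next
    case (Suc n)
    have e: "b \<otimes>\<^bsub>A\<^esub> gpow x (- int n) = b \<otimes>\<^bsub>A\<^esub> gpow x (- int (Suc n)) \<otimes>\<^bsub>A\<^esub> gen x"
      using next_gpow[of "- int (Suc n)"] by simp
    have t: "num (b \<otimes>\<^bsub>A\<^esub> gpow x (- int (Suc n))) (False, x) < 0"
      using Suc num_gen_True[OF c x, of "- int (Suc n)"] unfolding e by simp
    moreover have "level (b \<otimes>\<^bsub>A\<^esub> gpow x (- int (Suc n))) = Suc (level b + n)"
      using level_down[OF c x t] Suc unfolding e by simp
    ultimately show ?case using opp(1) by auto
  qed
  have "(num (b \<otimes>\<^bsub>A\<^esub> gpow x i) (False, x) < 0 \<longleftrightarrow> i < 0) \<and>
     (num (b \<otimes>\<^bsub>A\<^esub> gpow x i) (True, x) < 0 \<longleftrightarrow> 0 < i) \<and> level (b \<otimes>\<^bsub>A\<^esub> gpow x i) = level b + nat \<bar>i\<bar>" for i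
  proof (cases "0 \<le> i")
    case True
    then show ?thesis using pos[of "nat i"] by auto
  next
    case False
    then show ?thesis using neg[of "nat (- i)"] by auto
  qed
  then have "line x b" unfolding line_def using b by blast
  moreover have "g = b \<otimes>\<^bsub>A\<^esub> gpow x (- i0)"
    using g x by (simp add: b_def mult_gpow_gpow)
  ultimately show thesis using that by blast
qed

text \<open>Otherwise \<open>(True, x)\<close> and \<open>(False, y)\<close> are both descents, and one step back along the line the two
reflections \<open>(True, x)\<close>, \<open>(True, y)\<close>, which generate an infinite group, would be descents too.\<close>

lemma far_no_descent:
  assumes l: "line x b" and x: "x \<in> V" and j: "2 \<le> j"
  shows "0 < num (b \<otimes>\<^bsub>A\<^esub> gpow x j) (False, y)"
proof (rule ccontr)
  let ?h = "b \<otimes>\<^bsub>A\<^esub> gpow x j"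
  have b: "b \<in> carrier A" using l by (simp add: line_def)
  have c: "b \<otimes>\<^bsub>A\<^esub> gpow x i \<in> carrier A" for i using b x by simp
  assume "\<not> 0 < num ?h (False, y)"
  then have y: "num ?h (False, y) < 0"
    using num_nonzero[OF c] by (metis linorder_neqE_linordered_idom)
  have t: "num ?h (True, x) < 0" "num (b \<otimes>\<^bsub>A\<^esub> gpow x (j - 1)) (True, x) < 0"
    using l j unfolding line_def by auto
  have "b \<otimes>\<^bsub>A\<^esub> gpow x (j - 1) = ?h \<otimes>\<^bsub>A\<^esub> inv\<^bsub>A\<^esub> gen x"
    using b x mult_gpow_gen[of b x "j - 1"] gen_closed[OF x] by (simp add: inv_solve_right)
  then have "num (b \<otimes>\<^bsub>A\<^esub> gpow x (j - 1)) = swap (game.fire (True, x) (num ?h))"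
    using num_inv_gen[OF c x] by simp
  then have "num (b \<otimes>\<^bsub>A\<^esub> gpow x (j - 1)) (True, y) < 0"
    using game.fire_neg[of "(True, x)" "(False, y)" "num ?h"] t y by simp
  then have "x = y" using num_not_both_neg[OF c t(2)] by blast
  then show False using y l j unfolding line_def by auto
qed

end

subsection \<open>Elimination\<close>

primrec seqprod :: "('g, 'b) monoid_scheme \<Rightarrow> (nat \<Rightarrow> 'g) \<Rightarrow> nat \<Rightarrow> 'g" where
  "seqprod G a 0 = \<one>\<^bsub>G\<^esub>"
| "seqprod G a (Suc n) = seqprod G a n \<otimes>\<^bsub>G\<^esub> a n"

lemma seqprod_cong: "(\<And>i. i < n \<Longrightarrow> a i = b i) \<Longrightarrow> seqprod G a n = seqprod G b n"
  by (induction n) simp_all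

context group
begin

lemma seqprod_closed: "(\<And>i. i < n \<Longrightarrow> a i \<in> carrier G) \<Longrightarrow> seqprod G a n \<in> carrier G"
  by (induction n) simp_all

lemma seqprod_Suc2:
  "(\<And>i. i \<le> n \<Longrightarrow> a i \<in> carrier G) \<Longrightarrow> seqprod G a (Suc n) = a 0 \<otimes> seqprod G (\<lambda>i. a (Suc i)) n"
proof (induction n)
  case (Suc n)
  then have "seqprod G (\<lambda>i. a (Suc i)) n \<in> carrier G" by (intro seqprod_closed) simp
  then show ?case using Suc by (simp add: m_assoc)
qed simp

text \<open>Each extreme factor occurs on one side only and exactly once, so the relation can be
  solved for it: here for \<open>a 0\<close>, in the next lemma for
  \<open>a (Suc n)\<close>.\<close>

lemma seqprod_shift_iff_first:
  assumes "\<And>i. i \<le> Suc n \<Longrightarrow> a i \<in> carrier G"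
  shows "seqprod G a (Suc n) = seqprod G (\<lambda>i. a (Suc i)) (Suc n) \<longleftrightarrow>
    a 0 = seqprod G (\<lambda>i. a (Suc i)) (Suc n) \<otimes> inv (seqprod G (\<lambda>i. a (Suc i)) n)"
proof -
  have "seqprod G (\<lambda>i. a (Suc i)) n \<in> carrier G" "seqprod G (\<lambda>i. a (Suc i)) (Suc n) \<in> carrier G"
    using assms by (intro seqprod_closed; simp)+
  then show ?thesis
    using assms seqprod_Suc2[of n a] by (metis inv_solve_right le0 le_SucI)
qed

lemma seqprod_shift_iff_last:
  assumes "\<And>i. i \<le> Suc n \<Longrightarrow> a i \<in> carrier G"
  shows "seqprod G a (Suc n) = seqprod G (\<lambda>i. a (Suc i)) (Suc n) \<longleftrightarrow>
    a (Suc n) = inv (seqprod G (\<lambda>i. a (Suc i)) n) \<otimes> seqprod G a (Suc n)"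
proof -
  have "seqprod G (\<lambda>i. a (Suc i)) n \<in> carrier G" "seqprod G a (Suc n) \<in> carrier G"
    using assms by (intro seqprod_closed; simp)+
  then show ?thesis
    using assms[of "Suc n"] inv_solve_left[of "a (Suc n)" "seqprod G (\<lambda>i. a (Suc i)) n" "seqprod G a (Suc n)"]
    by simp
qed

end

text \<open>To be used for the graph without \<open>z\<close>: \<open>Lk\<close> is the set of
  neighbours of \<open>z\<close>, and \<open>k x\<close> is half the label of the edge from
  \<open>x\<close> to \<open>z\<close>.\<close>

locale elimination = large_even_graph V E m for V :: "'v set" and E :: "'v set set" and m +
  fixes Lk :: "'v set" and k :: "'v \<Rightarrow> nat"
  assumes Lk: "Lk \<subseteq> V" and k_ge_2: "x \<in> Lk \<Longrightarrow> 2 \<le> k x"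
begin

text \<open>On a line through \<open>b\<close> any \<open>k x\<close> consecutive values determine all others, by the relations \<open>window\<close>
below. The values at positions \<open>0, \<dots>, k x - 1\<close> are kept, and all others are eliminated.\<close>

definition eliminates :: "'v \<Rightarrow> 'v word set \<Rightarrow> bool" where
  "eliminates x h \<longleftrightarrow> x \<in> Lk \<and> (\<exists>b j. line x b \<and> h = b \<otimes>\<^bsub>A\<^esub> gpow x j \<and> (j < 0 \<or> int (k x) \<le> j))"

definition basis :: "'v word set set" where
  "basis = {h \<in> carrier A. \<forall>x. \<not> eliminates x h}"

lemma line_closed: "line x b \<Longrightarrow> x \<in> V \<Longrightarrow> b \<otimes>\<^bsub>A\<^esub> gpow x j \<in> carrier A"
  by (simp add: line_def)

lemma line_num:
  assumes "line x b"
  shows "num (b \<otimes>\<^bsub>A\<^esub> gpow x j) (False, x) < 0 \<longleftrightarrow> j < 0"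
    "num (b \<otimes>\<^bsub>A\<^esub> gpow x j) (True, x) < 0 \<longleftrightarrow> 0 < j"
    "level (b \<otimes>\<^bsub>A\<^esub> gpow x j) = level b + nat \<bar>j\<bar>"
  using assms unfolding line_def by blast+

text \<open>An element eliminated on the left of a line has the descent \<open>(False, x)\<close>,
  on the right \<open>(True, x)\<close>. Two eliminations in the same direction give two descents in
  one copy; opposite directions contradict \<open>far_no_descent\<close>, which applies on the right
  since \<open>k x\<close> is at least 2.\<close>

lemma eliminates_unique:
  assumes "eliminates x h" "eliminates y h"
  shows "x = y"
proof -
  obtain b i where b: "line x b" "h = b \<otimes>\<^bsub>A\<^esub> gpow x i" "i < 0 \<or> int (k x) \<le> i" "x \<in> Lk"
    using assms(1) unfolding eliminates_def by blast
  obtain c j where c: "line y c" "h = c \<otimes>\<^bsub>A\<^esub> gpow y j" "j < 0 \<or> int (k y) \<le> j" "y \<in> Lk"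
    using assms(2) unfolding eliminates_def by blast
  have V: "x \<in> V" "y \<in> V" using b c Lk by auto
  have h: "h \<in> carrier A" using b line_closed V by blast
  have i: "i < 0 \<or> 2 \<le> i" using b(3) k_ge_2[OF b(4)] by linarith
  have j: "j < 0 \<or> 2 \<le> j" using c(3) k_ge_2[OF c(4)] by linarith
  show ?thesis
  proof (cases "i < 0 \<longleftrightarrow> j < 0")
    case True
    then have "(num h (False, x) < 0 \<and> num h (False, y) < 0) \<or> (num h (True, x) < 0 \<and> num h (True, y) < 0)"
      using line_num(1,2)[OF b(1), of i] line_num(1,2)[OF c(1), of j] b(2) c(2) i j by auto
    then show ?thesis using num_not_both_neg[OF h] by blast
  next
    case False
    then have "(num h (False, x) < 0 \<and> 0 < num h (False, x)) \<or> (num h (False, y) < 0 \<and> 0 < num h (False, y))"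
      using line_num(1)[OF b(1), of i] line_num(1)[OF c(1), of j] b(2) c(2) i j
        far_no_descent[OF b(1) V(1), of i] far_no_descent[OF c(1) V(2), of j] by auto
    then show ?thesis by auto
  qed
qed

text \<open>\<open>far_no_descent\<close> excludes any elimination on the left. One on the right
  along \<open>y\<close> would give the descents \<open>(True, y)\<close> and
  \<open>(True, x)\<close>, so \<open>y = x\<close>; the shortest element of the line being unique,
  the position is still \<open>i\<close>, which is too small.\<close>

lemma line_in_basis:
  assumes l: "line x b" and x: "x \<in> Lk" and i: "2 \<le> i" "i < int (k x)"
  shows "b \<otimes>\<^bsub>A\<^esub> gpow x i \<in> basis"
proof -
  let ?h = "b \<otimes>\<^bsub>A\<^esub> gpow x i"
  have V: "x \<in> V" using x Lk by auto
  have "\<not> eliminates y ?h" for y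
  proof
    assume "eliminates y ?h"
    then obtain c j where c: "line y c" "?h = c \<otimes>\<^bsub>A\<^esub> gpow y j" "j < 0 \<or> int (k y) \<le> j" "y \<in> Lk"
      unfolding eliminates_def by blast
    have "0 < num ?h (False, y)" using far_no_descent[OF l V i(1)] .
    then have j: "int (k y) \<le> j" using c line_num(1)[OF c(1), of j] by auto
    then have "num ?h (True, y) < 0" "num ?h (True, x) < 0"
      using line_num(2)[OF c(1), of j] c(2) k_ge_2[OF c(4)] line_num(2)[OF l, of i] i by auto
    then have xy: "y = x" using num_not_both_neg line_closed[OF l V] by blast
    have b: "b \<in> carrier A" "c \<in> carrier A" using l c by (simp_all add: line_def)
    have "c = ?h \<otimes>\<^bsub>A\<^esub> gpow x (- j)" using c(2) b V xy by (simp add: mult_gpow_gpow)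
    then have cb: "c = b \<otimes>\<^bsub>A\<^esub> gpow x (i - j)" using b V by (simp add: mult_gpow_gpow)
    have "num c (True, x) < 0 \<longleftrightarrow> 0 < i - j" "num c (False, x) < 0 \<longleftrightarrow> i - j < 0"
      using line_num(1,2)[OF l, of "i - j"] cb by simp_all
    moreover have "\<not> num c (True, x) < 0" "\<not> num c (False, x) < 0"
      using line_num(1,2)[OF c(1), of 0] b V xy by simp_all
    ultimately show False using j i xy by simp
  qed
  then show ?thesis using line_closed[OF l V] by (simp add: basis_def)
qed

text \<open>Eliminating position \<open>-1\<close> uses position \<open>1\<close>, which has the same level. This is where \<open>zigzag\<close> is needed.\<close>

definition prec :: "('v word set \<times> 'v word set) set" where
  "prec = inv_image (less_than <*lex*> less_than <*lex*> game.zigzag)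
     (\<lambda>h. (if h \<in> basis then 0 else 1, level h, num h))"

lemma wf_prec: "wf prec"
  unfolding prec_def by (intro wf_inv_image wf_lex_prod wf_less_than game.wf_zigzag)

text \<open>The window starting at \<open>j < 0\<close> may reach longer elements, but only at
  positions from 2 on, which are kept. Positions closer to 0 than \<open>j\<close> are shorter. The
  single remaining case is position 1 for \<open>j = -1\<close>.\<close>

lemma prec_left:
  assumes l: "line x b" and x: "x \<in> Lk" and j: "j < 0" and i: "0 < i" "i \<le> k x"
  shows "(b \<otimes>\<^bsub>A\<^esub> gpow x (j + int i), b \<otimes>\<^bsub>A\<^esub> gpow x j) \<in> prec"
proof -
  have V: "x \<in> V" using x Lk by auto
  have b: "b \<in> carrier A" using l by (simp add: line_def)
  have n: "b \<otimes>\<^bsub>A\<^esub> gpow x j \<notin> basis"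
    using l x j unfolding basis_def eliminates_def by blast
  consider "2 \<le> j + int i" | "\<bar>j + int i\<bar> < \<bar>j\<bar>" | "j = -1" "i = 2" using j i(1) by linarith
  then show ?thesis
  proof cases
    case 1
    have "j + int i < int (k x)" using j i(2) by linarith
    then show ?thesis using line_in_basis[OF l x 1] n by (simp add: prec_def)
  next
    case 2
    then have "level (b \<otimes>\<^bsub>A\<^esub> gpow x (j + int i)) < level (b \<otimes>\<^bsub>A\<^esub> gpow x j)"
      unfolding line_num(3)[OF l] by linarith
    then show ?thesis using n by (simp add: prec_def)
  next
    case 3
    have level: "level (b \<otimes>\<^bsub>A\<^esub> gpow x 1) = level (b \<otimes>\<^bsub>A\<^esub> gpow x (-1))"
      unfolding line_num(3)[OF l] by simp
    \<comment> \<open>Up to a swap, \<open>c\<close> is \<open>num b\<close>. It is the valley from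
      which position -1 is reached through \<open>(False, x)\<close> and position 1 through
      \<open>(True, x)\<close>.\<close>
    define c where "c = game.fire (False, x) (num (b \<otimes>\<^bsub>A\<^esub> gpow x (-1)))"
    have e: "b \<otimes>\<^bsub>A\<^esub> gpow x (-1) \<otimes>\<^bsub>A\<^esub> gen x = b" using mult_gpow_gen[OF b V, of "-1"] b by simp
    then have nb: "num b = swap c"
      using num_gen[OF line_closed[OF l V, of "-1"] V] by (simp add: act_def c_def)
    then have cb: "c = swap (num b)" by simp
    have "\<not> num b (False, x) < 0" "\<not> num b (True, x) < 0"
      using line_num(1,2)[OF l, of 0] b V by simp_all
    then have pos: "0 < c (False, x)" "0 < c (True, x)"
      using num_nonzero[OF b, of "(False, x)"] num_nonzero[OF b, of "(True, x)"] by (simp_all add: cb)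
    have "num (b \<otimes>\<^bsub>A\<^esub> gpow x 1) = game.fire (True, x) c"
      using num_gen[OF b V] V by (simp add: act_def swap_fire cb)
    moreover have "num (b \<otimes>\<^bsub>A\<^esub> gpow x (-1)) = game.fire (False, x) c"
      by (simp add: c_def)
    moreover have "game.lev (level b) c" using lev_swap[OF lev_level[OF b]] cb by simp
    ultimately have "(num (b \<otimes>\<^bsub>A\<^esub> gpow x 1), num (b \<otimes>\<^bsub>A\<^esub> gpow x (-1))) \<in> game.zigzag"
      unfolding game.zigzag_def using pos by fastforce
    then show ?thesis using 3 level n by (simp add: prec_def)
  qed
qed

lemma prec_right:
  assumes l: "line x b" and x: "x \<in> Lk" and j: "0 \<le> j" and i: "i < k x"
  shows "(b \<otimes>\<^bsub>A\<^esub> gpow x (j + int i), b \<otimes>\<^bsub>A\<^esub> gpow x (j + int (k x))) \<in> prec"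
proof -
  have "b \<otimes>\<^bsub>A\<^esub> gpow x (j + int (k x)) \<notin> basis"
    using l x j unfolding basis_def eliminates_def by force
  moreover have "level (b \<otimes>\<^bsub>A\<^esub> gpow x (j + int i)) < level (b \<otimes>\<^bsub>A\<^esub> gpow x (j + int (k x)))"
    unfolding line_num(3)[OF l] using i j by linarith
  ultimately show ?thesis by (simp add: prec_def)
qed

definition window :: "('g, 'c) monoid_scheme \<Rightarrow> ('v word set \<Rightarrow> 'g) \<Rightarrow> 'v word set \<Rightarrow> 'v \<Rightarrow> bool" where
  "window F \<zeta> g x \<longleftrightarrow> seqprod F (\<lambda>i. \<zeta> (g \<otimes>\<^bsub>A\<^esub> gpow x (int i))) (k x)
     = seqprod F (\<lambda>i. \<zeta> (g \<otimes>\<^bsub>A\<^esub> gpow x (int (Suc i)))) (k x)"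

text \<open>One step of the recursion, with \<open>r\<close> holding the values at smaller elements.
  The sign at \<open>(False, x)\<close> tells on which side of the line \<open>h\<close> lies; the
  window starting or ending at \<open>h\<close> is solved for it accordingly.\<close>

definition eliminator :: "('g, 'c) monoid_scheme \<Rightarrow> ('v word set \<Rightarrow> 'g) \<Rightarrow>
    ('v word set \<Rightarrow> 'g) \<Rightarrow> 'v word set \<Rightarrow> 'g" where
  "eliminator F \<xi> r h = (if h \<in> basis then \<xi> h else
     let x = THE x. eliminates x h in
     if num h (False, x) < 0
     then seqprod F (\<lambda>i. r (h \<otimes>\<^bsub>A\<^esub> gpow x (int (Suc i)))) (k x)
       \<otimes>\<^bsub>F\<^esub> inv\<^bsub>F\<^esub> seqprod F (\<lambda>i. r (h \<otimes>\<^bsub>A\<^esub> gpow x (int (Suc i)))) (k x - 1)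
     else inv\<^bsub>F\<^esub> seqprod F (\<lambda>i. r (h \<otimes>\<^bsub>A\<^esub> gpow x (int (Suc i) - int (k x)))) (k x - 1)
       \<otimes>\<^bsub>F\<^esub> seqprod F (\<lambda>i. r (h \<otimes>\<^bsub>A\<^esub> gpow x (int i - int (k x)))) (k x))"

lemma eliminator_cases:
  assumes h: "h \<in> carrier A"
  obtains "h \<in> basis"
    | x b j where "x \<in> Lk" "line x b" "h = b \<otimes>\<^bsub>A\<^esub> gpow x j" "j < 0" "h \<notin> basis" "(THE x. eliminates x h) = x"
        "num h (False, x) < 0" "\<And>i. h \<otimes>\<^bsub>A\<^esub> gpow x i = b \<otimes>\<^bsub>A\<^esub> gpow x (j + i)"
    | x b j where "x \<in> Lk" "line x b" "h = b \<otimes>\<^bsub>A\<^esub> gpow x (j + int (k x))" "0 \<le> j" "h \<notin> basis" "(THE x. eliminates x h) = x"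
        "\<not> num h (False, x) < 0" "\<And>i. h \<otimes>\<^bsub>A\<^esub> gpow x (i - int (k x)) = b \<otimes>\<^bsub>A\<^esub> gpow x (j + i)"
proof (cases "h \<in> basis")
  case False
  then obtain x where x: "eliminates x h" using h unfolding basis_def by blast
  then have the: "(THE x. eliminates x h) = x" using eliminates_unique by blast
  obtain b j where b: "x \<in> Lk" "line x b" "h = b \<otimes>\<^bsub>A\<^esub> gpow x j" "j < 0 \<or> int (k x) \<le> j"
    using x unfolding eliminates_def by blast
  have bA: "b \<in> carrier A" "x \<in> V" using b Lk by (auto simp: line_def)
  show thesis
  proof (cases "j < 0")
    case True
    then show thesis
      using that(2)[of x b j] b False the line_num(1)[OF b(2), of j] bA by (simp add: mult_gpow_gpow)
  next
    case nn: False
    then show thesis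
      using that(3)[of x b "j - int (k x)"] b False the line_num(1)[OF b(2), of j] bA
      by (simp add: mult_gpow_gpow algebra_simps)
  qed
qed (use that(1) in blast)

text \<open>Each window is the defining equation of one value: starting at position
  \<open>j\<close>, it defines position \<open>j\<close> if \<open>j < 0\<close> and position
  \<open>j + k x\<close> otherwise. So the recursion along \<open>prec\<close> satisfies all windows
  at once.\<close>

lemma ex_elimination:
  assumes F: "group F" and \<xi>: "\<xi> ` basis \<subseteq> carrier F"
  obtains \<zeta> where "\<And>h. h \<in> carrier A \<Longrightarrow> \<zeta> h \<in> carrier F" "\<And>h. h \<in> basis \<Longrightarrow> \<zeta> h = \<xi> h"
    "\<And>g x. g \<in> carrier A \<Longrightarrow> x \<in> Lk \<Longrightarrow> window F \<zeta> g x"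
proof -
  interpret F: group F by fact
  define \<zeta> where "\<zeta> = wfrec prec (eliminator F \<xi>)"
  have rec: "\<zeta> h = eliminator F \<xi> (cut \<zeta> prec h) h" for h
    unfolding \<zeta>_def by (rule wfrec[OF wf_prec])
  have basis: "\<zeta> h = \<xi> h" if "h \<in> basis" for h
    using that by (simp add: rec[of h] eliminator_def)
  have left: "\<zeta> (b \<otimes>\<^bsub>A\<^esub> gpow x j) = seqprod F (\<lambda>i. \<zeta> (b \<otimes>\<^bsub>A\<^esub> gpow x (j + int (Suc i)))) (k x)
       \<otimes>\<^bsub>F\<^esub> inv\<^bsub>F\<^esub> seqprod F (\<lambda>i. \<zeta> (b \<otimes>\<^bsub>A\<^esub> gpow x (j + int (Suc i)))) (k x - 1)"
    if H: "x \<in> Lk" "line x b" "j < 0" for x b j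
  proof -
    let ?h = "b \<otimes>\<^bsub>A\<^esub> gpow x j"
    have bA: "b \<in> carrier A" "x \<in> V" using H Lk by (auto simp: line_def)
    have el: "eliminates x ?h" using H unfolding eliminates_def by blast
    then have the: "(THE x. eliminates x ?h) = x" "?h \<notin> basis"
      using eliminates_unique by (auto simp: basis_def)
    have "cut \<zeta> prec ?h (?h \<otimes>\<^bsub>A\<^esub> gpow x (int (Suc i))) = \<zeta> (b \<otimes>\<^bsub>A\<^esub> gpow x (j + int (Suc i)))" if "i < k x" for i
      using cut_apply[OF prec_left[OF H(2,1,3), of "Suc i"]] that bA mult_gpow_gpow[OF bA, of j "int (Suc i)"] by simp
    then show ?thesis
      using the line_num(1)[OF H(2), of j] H(3)
      unfolding rec[of ?h] eliminator_def
      by (simp add: Let_def cong: seqprod_cong)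
  qed
  have right: "\<zeta> (b \<otimes>\<^bsub>A\<^esub> gpow x (j + int (k x))) = inv\<^bsub>F\<^esub> seqprod F (\<lambda>i. \<zeta> (b \<otimes>\<^bsub>A\<^esub> gpow x (j + int (Suc i)))) (k x - 1)
       \<otimes>\<^bsub>F\<^esub> seqprod F (\<lambda>i. \<zeta> (b \<otimes>\<^bsub>A\<^esub> gpow x (j + int i))) (k x)"
    if H: "x \<in> Lk" "line x b" "0 \<le> j" for x b j
  proof -
    let ?h = "b \<otimes>\<^bsub>A\<^esub> gpow x (j + int (k x))"
    have bA: "b \<in> carrier A" "x \<in> V" using H Lk by (auto simp: line_def)
    have "eliminates x ?h" using H unfolding eliminates_def by force
    then have the: "(THE x. eliminates x ?h) = x" "?h \<notin> basis"
      using eliminates_unique by (auto simp: basis_def)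
    have *: "cut \<zeta> prec ?h (?h \<otimes>\<^bsub>A\<^esub> gpow x (int i - int (k x))) = \<zeta> (b \<otimes>\<^bsub>A\<^esub> gpow x (j + int i))" if "i < k x" for i
      using cut_apply[OF prec_right[OF H(2,1,3) that]] mult_gpow_gpow[OF bA, of "j + int (k x)" "int i - int (k x)"] by simp
    have "\<not> num ?h (False, x) < 0"
      using line_num(1)[OF H(2), of "j + int (k x)"] H(3) by simp
    then have "\<zeta> ?h = inv\<^bsub>F\<^esub> seqprod F (\<lambda>i. cut \<zeta> prec ?h (?h \<otimes>\<^bsub>A\<^esub> gpow x (int (Suc i) - int (k x)))) (k x - 1)
       \<otimes>\<^bsub>F\<^esub> seqprod F (\<lambda>i. cut \<zeta> prec ?h (?h \<otimes>\<^bsub>A\<^esub> gpow x (int i - int (k x)))) (k x)"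
      using the unfolding rec[of ?h] eliminator_def by (simp add: Let_def)
    also have "seqprod F (\<lambda>i. cut \<zeta> prec ?h (?h \<otimes>\<^bsub>A\<^esub> gpow x (int (Suc i) - int (k x)))) (k x - 1)
        = seqprod F (\<lambda>i. \<zeta> (b \<otimes>\<^bsub>A\<^esub> gpow x (j + int (Suc i)))) (k x - 1)"
      by (rule seqprod_cong) (use *[of "Suc _"] in auto)
    also have "seqprod F (\<lambda>i. cut \<zeta> prec ?h (?h \<otimes>\<^bsub>A\<^esub> gpow x (int i - int (k x)))) (k x)
        = seqprod F (\<lambda>i. \<zeta> (b \<otimes>\<^bsub>A\<^esub> gpow x (j + int i))) (k x)"
      by (rule seqprod_cong) (rule *)
    finally show ?thesis .
  qed
  have closed: "\<zeta> h \<in> carrier F" if "h \<in> carrier A" for h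
    using wf_prec that
  proof (induction h)
    case (less h)
    then show ?case
    proof (cases rule: eliminator_cases[OF less.prems])
      case 1
      then show ?thesis using basis \<xi> by auto
    next
      case (2 x b j)
      have V: "x \<in> V" using 2(1) Lk by auto
      have "\<zeta> (b \<otimes>\<^bsub>A\<^esub> gpow x (j + int (Suc i))) \<in> carrier F" if "i < k x" for i
        using less.IH prec_left[OF 2(2,1,4), of "Suc i"] that 2(3) line_closed[OF 2(2) V] by simp
      then show ?thesis unfolding 2(3) left[OF 2(1,2,4)]
        by (intro F.m_closed F.inv_closed F.seqprod_closed) auto
    next
      case (3 x b j)
      have V: "x \<in> V" using 3(1) Lk by auto
      have "\<zeta> (b \<otimes>\<^bsub>A\<^esub> gpow x (j + int i)) \<in> carrier F" if "i < k x" for i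
        using less.IH prec_right[OF 3(2,1,4), of i] that 3(3) line_closed[OF 3(2) V] by simp
      note c = this
      have "\<zeta> (b \<otimes>\<^bsub>A\<^esub> gpow x (j + int (Suc i))) \<in> carrier F" if "i < k x - 1" for i
        using that by (intro c) simp
      then show ?thesis unfolding 3(3) right[OF 3(1,2,4)]
        using c by (intro F.m_closed F.inv_closed F.seqprod_closed)
    qed
  qed
  have "window F \<zeta> g x" if g: "g \<in> carrier A" and x: "x \<in> Lk" for g x
  proof -
    have V: "x \<in> V" using x Lk by auto
    obtain b j where b: "line x b" "g = b \<otimes>\<^bsub>A\<^esub> gpow x j" using line_exists[OF g V] .
    have bA: "b \<in> carrier A" using b by (simp add: line_def)
    obtain n where n: "k x = Suc n" using k_ge_2[OF x] by (metis Suc_le_D numeral_2_eq_2)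
    define a where "a = (\<lambda>i. \<zeta> (b \<otimes>\<^bsub>A\<^esub> gpow x (j + int i)))"
    have a: "a i \<in> carrier F" for i unfolding a_def using closed line_closed[OF b(1) V] by blast
    have "seqprod F a (Suc n) = seqprod F (\<lambda>i. a (Suc i)) (Suc n)"
    proof (cases "j < 0")
      case True
      have "a 0 = seqprod F (\<lambda>i. a (Suc i)) (Suc n) \<otimes>\<^bsub>F\<^esub> inv\<^bsub>F\<^esub> (seqprod F (\<lambda>i. a (Suc i)) n)"
        using left[OF x b(1) True] by (simp add: a_def n)
      then show ?thesis using F.seqprod_shift_iff_first a by blast
    next
      case False
      then have "a (Suc n) = inv\<^bsub>F\<^esub> (seqprod F (\<lambda>i. a (Suc i)) n) \<otimes>\<^bsub>F\<^esub> seqprod F a (Suc n)"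
        using right[OF x b(1), of j] by (simp add: a_def n)
      then show ?thesis using F.seqprod_shift_iff_last a by blast
    qed
    moreover have "g \<otimes>\<^bsub>A\<^esub> gpow x i = b \<otimes>\<^bsub>A\<^esub> gpow x (j + i)" for i
      using b(2) bA V by (simp add: mult_gpow_gpow)
    ultimately show ?thesis unfolding window_def n a_def by simp
  qed
  then show thesis using that closed basis by blast
qed

text \<open>The uniqueness counterpart of \<open>ex_elimination\<close>: in any solution an
  eliminated value is a product of values at smaller elements and their inverses.\<close>

lemma generate_basis:
  assumes F: "group F" and s: "\<And>h. h \<in> carrier A \<Longrightarrow> s h \<in> carrier F"
    and w: "\<And>g x. g \<in> carrier A \<Longrightarrow> x \<in> Lk \<Longrightarrow> window F s g x" and h: "h \<in> carrier A"
  shows "s h \<in> generate F (s ` basis)"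
  using wf_prec h
proof (induction h)
  case (less h)
  interpret F: group F by fact
  let ?Z = "generate F (s ` basis)"
  have "s ` basis \<subseteq> carrier F" using s by (auto simp: basis_def)
  then interpret Z: subgroup ?Z F by (rule F.generate_is_subgroup)
  have prod: "seqprod F a n \<in> ?Z" if "\<And>i. i < n \<Longrightarrow> a i \<in> ?Z" for a and n
    using that by (induction n) (auto simp: Z.one_closed)
  show ?case
  proof (cases rule: eliminator_cases[OF less.prems])
    case 1
    then show ?thesis by (auto intro: generate.incl)
  next
    case (2 x b j)
    have V: "x \<in> V" using 2 Lk by auto
    obtain n where n: "k x = Suc n" using k_ge_2[OF 2(1)] by (metis Suc_le_D numeral_2_eq_2)
    define a where "a = (\<lambda>i. s (b \<otimes>\<^bsub>A\<^esub> gpow x (j + int i)))"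
    have a: "a i \<in> carrier F" for i unfolding a_def using s line_closed[OF 2(2) V] by blast
    have Z: "a (Suc i) \<in> ?Z" if "i < Suc n" for i
      unfolding a_def using less.IH prec_left[OF 2(2,1,4), of "Suc i"] that n 2(3) line_closed[OF 2(2) V] by simp
    have "window F s h x" using w[OF less.prems 2(1)] .
    then have "seqprod F a (Suc n) = seqprod F (\<lambda>i. a (Suc i)) (Suc n)"
      unfolding window_def n a_def 2(8) .
    then have "a 0 = seqprod F (\<lambda>i. a (Suc i)) (Suc n) \<otimes>\<^bsub>F\<^esub> inv\<^bsub>F\<^esub> (seqprod F (\<lambda>i. a (Suc i)) n)"
      using F.seqprod_shift_iff_first a by blast
    moreover have "seqprod F (\<lambda>i. a (Suc i)) (Suc n) \<in> ?Z" "seqprod F (\<lambda>i. a (Suc i)) n \<in> ?Z"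
      using Z by (intro prod; simp)+
    ultimately show ?thesis using 2(3) by (simp add: a_def)
  next
    case (3 x b j)
    have V: "x \<in> V" using 3 Lk by auto
    have bA: "b \<in> carrier A" using 3 by (simp add: line_def)
    obtain n where n: "k x = Suc n" using k_ge_2[OF 3(1)] by (metis Suc_le_D numeral_2_eq_2)
    define a where "a = (\<lambda>i. s (b \<otimes>\<^bsub>A\<^esub> gpow x (j + int i)))"
    have a: "a i \<in> carrier F" for i unfolding a_def using s line_closed[OF 3(2) V] by blast
    have Z: "a i \<in> ?Z" if "i < Suc n" for i
      unfolding a_def using less.IH prec_right[OF 3(2,1,4), of i] that n 3(3) line_closed[OF 3(2) V] by simp
    have "window F s (b \<otimes>\<^bsub>A\<^esub> gpow x j) x" using w[OF line_closed[OF 3(2) V] 3(1)] .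
    then have "seqprod F a (Suc n) = seqprod F (\<lambda>i. a (Suc i)) (Suc n)"
      unfolding window_def n a_def mult_gpow_gpow[OF bA V] .
    then have "a (Suc n) = inv\<^bsub>F\<^esub> (seqprod F (\<lambda>i. a (Suc i)) n) \<otimes>\<^bsub>F\<^esub> seqprod F a (Suc n)"
      using F.seqprod_shift_iff_last a by blast
    moreover have "seqprod F a (Suc n) \<in> ?Z" "seqprod F (\<lambda>i. a (Suc i)) n \<in> ?Z"
      using Z by (intro prod; simp)+
    ultimately show ?thesis using 3(3) n by (simp add: a_def)
  qed
qed

end

subsection \<open>The kernel of a vertex retraction\<close>

lemma ev_free_grp:
  assumes "reduced w" "snd ` set w \<subseteq> T"
  shows "ev (free_grp T) (\<lambda>t. [(True, t)]) w = w"
proof -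
  interpret group "free_grp T" by (rule free_grp_group)
  let ?\<xi> = "\<lambda>t. [(True, t)]"
  have inv: "inv\<^bsub>free_grp T\<^esub> [(True, t)] = [(False, t)]" if "t \<in> T" for t
    using that by (intro inv_equality) (auto simp: free_grp_def reduced_def)
  have "ev (free_grp T) ?\<xi> w = red w"
    using assms(2)
  proof (induction w)
    case (Cons x w)
    have "(if fst x then [(True, snd x)] else inv\<^bsub>free_grp T\<^esub> [(True, snd x)]) = [x]"
      using Cons.prems inv by (cases x) auto
    then have "ev (free_grp T) ?\<xi> (x # w) = [x] \<otimes>\<^bsub>free_grp T\<^esub> red w"
      using Cons unfolding ev_Cons by simp
    also have "\<dots> = red ([x] @ red w)" by (simp only: free_grp_def monoid.select_convs)
    finally show ?case unfolding red_append_right by simp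
  qed (simp add: free_grp_def)
  then show ?thesis using assms(1) by (simp add: reduced_def)
qed

locale vertex_removal = large_even_graph V E m for V :: "'v set" and E :: "'v set set" and m +
  fixes z :: 'v
  assumes z: "z \<in> V"
begin

abbreviation "V' \<equiv> V - {z}"
abbreviation "E' \<equiv> {e \<in> E. z \<notin> e}"

lemma subgraph: "labelled_graph V' E' m"
  using graph unfolding labelled_graph_def by fastforce

sublocale H: elimination V' E' m "{x. {x, z} \<in> E}" "\<lambda>x. half {x, z}"
proof
  show "labelled_graph V' E' m" by (rule subgraph)
  show "even_artin E' m" using even_m by (simp add: even_artin_def)
  show "large_artin E' m" using large by (simp add: large_artin_def)
  show "{x. {x, z} \<in> E} \<subseteq> V'" using edge_vertices by blast
qed (use half_ge_2 in auto)

abbreviation "B \<equiv> artin_group V' E' m"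

lemma gen'_closed: "v \<in> V \<Longrightarrow> v \<noteq> z \<Longrightarrow> H.gen v \<in> carrier B"
  by (rule H.gen_closed) simp

text \<open>Evenness is what permits killing \<open>z\<close>: at an edge from \<open>x\<close> to
  \<open>z\<close> both sides of the relation become the same power of
  \<open>H.gen x\<close>.\<close>

lemma ex_retraction: "\<exists>\<rho> \<in> hom A B. \<rho> (gen z) = \<one>\<^bsub>B\<^esub> \<and> (\<forall>v\<in>V'. \<rho> (gen v) = H.gen v)"
proof -
  let ?\<phi> = "\<lambda>v. if v = z then \<one>\<^bsub>B\<^esub> else H.gen v"
  obtain \<rho> where "\<rho> \<in> hom A B" "\<And>v. v \<in> V \<Longrightarrow> \<rho> (gen v) = ?\<phi> v"
  proof (rule universal[of B ?\<phi>])
    fix u v assume uv: "{u, v} \<in> E"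
    show "(?\<phi> u \<otimes>\<^bsub>B\<^esub> ?\<phi> v) [^]\<^bsub>B\<^esub> half {u, v} = (?\<phi> v \<otimes>\<^bsub>B\<^esub> ?\<phi> u) [^]\<^bsub>B\<^esub> half {u, v}"
      using H.relation[of u v] uv edge_vertices[OF uv] gen'_closed[of u] gen'_closed[of v]
      by auto
  qed (use gen'_closed in auto)
  then show ?thesis using z by (intro bexI[of _ \<rho>]) auto
qed

lemma ex_section: "\<exists>\<iota> \<in> hom B A. \<forall>v\<in>V'. \<iota> (H.gen v) = gen v"
proof -
  obtain \<iota> where "\<iota> \<in> hom B A" "\<And>v. v \<in> V' \<Longrightarrow> \<iota> (H.gen v) = gen v"
    by (rule H.universal[of A gen]) (use relation gen_closed is_group in auto)
  then show ?thesis by blast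
qed

end

locale split_removal = vertex_removal +
  fixes \<rho> \<iota> :: "'a word set \<Rightarrow> 'a word set"
  assumes rho_hom: "\<rho> \<in> hom A B" and rho_z: "\<rho> (gen z) = \<one>\<^bsub>B\<^esub>"
    and rho_gen: "v \<in> V' \<Longrightarrow> \<rho> (gen v) = H.gen v"
    and iota_hom: "\<iota> \<in> hom B A" and iota_gen: "v \<in> V' \<Longrightarrow> \<iota> (H.gen v) = gen v"
begin

sublocale \<rho>: group_hom A B \<rho>
  using rho_hom is_group H.is_group by (intro group_hom.intro group_hom_axioms.intro)

sublocale \<iota>: group_hom B A \<iota>
  using iota_hom is_group H.is_group by (intro group_hom.intro group_hom_axioms.intro)

lemma rho_iota: "h \<in> carrier B \<Longrightarrow> \<rho> (\<iota> h) = h"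
proof -
  assume h: "h \<in> carrier B"
  have "(\<rho> \<circ> \<iota>) h = id h"
  proof (rule H.hom_eqI[OF H.is_group _ _ _ h])
    show "\<rho> \<circ> \<iota> \<in> hom B B" by (rule Group.hom_compose[OF iota_hom rho_hom])
    show "id \<in> hom B B" by (rule homI) (simp_all only: id_apply)
    show "(\<rho> \<circ> \<iota>) (H.gen v) = id (H.gen v)" if "v \<in> V'" for v
      by (simp only: comp_apply id_apply iota_gen[OF that] rho_gen[OF that])
  qed
  then show ?thesis by (simp only: comp_apply id_apply)
qed

lemma rho_surj: "\<rho> ` carrier A = carrier B"
proof
  show "\<rho> ` carrier A \<subseteq> carrier B" using \<rho>.hom_closed by (rule image_subsetI)
  show "carrier B \<subseteq> \<rho> ` carrier A"
  proof
    fix h assume h: "h \<in> carrier B"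
    show "h \<in> \<rho> ` carrier A"
      by (rule image_eqI[where x = "\<iota> h"]) (simp_all add: rho_iota h)
  qed
qed

lemma z_closed: "gen z \<in> carrier A"
  using gen_closed z .

definition conj_z :: "'a word set \<Rightarrow> 'a word set" where
  "conj_z h = \<iota> h \<otimes>\<^bsub>A\<^esub> gen z \<otimes>\<^bsub>A\<^esub> inv\<^bsub>A\<^esub> \<iota> h"

lemma conj_z_closed: "h \<in> carrier B \<Longrightarrow> conj_z h \<in> carrier A"
  by (simp add: conj_z_def z_closed)

lemma conj_z_iota: "h \<in> carrier B \<Longrightarrow> conj_z h \<otimes>\<^bsub>A\<^esub> \<iota> h = \<iota> h \<otimes>\<^bsub>A\<^esub> gen z"
  by (simp add: conj_z_def z_closed m_assoc)

lemma conj_z_kernel: "h \<in> carrier B \<Longrightarrow> conj_z h \<in> kernel A B \<rho>"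
  by (simp add: conj_z_def kernel_def rho_z rho_iota z_closed)

text \<open>This is the relation \<open>(z x)\<^sup>k = (x z)\<^sup>k\<close> conjugated by \<open>\<iota> h\<close> and rewritten in the kernel.\<close>

lemma window_conj_z:
  assumes h: "h \<in> carrier B" and x: "{x, z} \<in> E"
  shows "H.window A conj_z h x"
proof -
  have V: "x \<in> V'" using edge_vertices[OF x] by auto
  have xA: "gen x \<in> carrier A" using V gen_closed by simp
  let ?h = "\<lambda>n. h \<otimes>\<^bsub>B\<^esub> H.gpow x (int n)"
  have hc: "?h n \<in> carrier B" for n using h V by simp
  have ic: "\<iota> (?h n) \<in> carrier A" "\<iota> h \<in> carrier A" for n using hc h by simp_all
  have sc: "conj_z (?h n) \<in> carrier A" for n using hc conj_z_closed by blast
  have step: "\<iota> (?h (Suc n)) = \<iota> (?h n) \<otimes>\<^bsub>A\<^esub> gen x" for n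
  proof -
    have "?h (Suc n) = ?h n \<otimes>\<^bsub>B\<^esub> H.gen x"
      using H.mult_gpow_gen[OF h V, of "int n"] by (simp add: add.commute)
    then show ?thesis
      using \<iota>.hom_mult[OF hc H.gen_closed[OF V]] iota_gen[OF V] by simp
  qed
  have P: "seqprod A (\<lambda>i. conj_z (?h i)) n \<in> carrier A" "seqprod A (\<lambda>i. conj_z (?h (Suc i))) n \<in> carrier A" for n
    by (rule seqprod_closed, rule sc)+
  \<comment> \<open>Between consecutive conjugates the inverse of one \<iota>-image meets the next
    image and leaves \<open>gen x\<close>, so the product telescopes.\<close>
  have 1: "seqprod A (\<lambda>i. conj_z (?h i)) n \<otimes>\<^bsub>A\<^esub> \<iota> (?h n) = \<iota> h \<otimes>\<^bsub>A\<^esub> (gen z \<otimes>\<^bsub>A\<^esub> gen x) [^]\<^bsub>A\<^esub> n" for n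
  proof (induction n)
    case 0
    then show ?case using h by simp
  next
    case (Suc n)
    have "seqprod A (\<lambda>i. conj_z (?h i)) (Suc n) \<otimes>\<^bsub>A\<^esub> \<iota> (?h (Suc n))
        = seqprod A (\<lambda>i. conj_z (?h i)) n \<otimes>\<^bsub>A\<^esub> (conj_z (?h n) \<otimes>\<^bsub>A\<^esub> \<iota> (?h n)) \<otimes>\<^bsub>A\<^esub> gen x"
      unfolding step seqprod.simps by (simp only: m_assoc P sc ic xA m_closed)
    also have "\<dots> = seqprod A (\<lambda>i. conj_z (?h i)) n \<otimes>\<^bsub>A\<^esub> \<iota> (?h n) \<otimes>\<^bsub>A\<^esub> (gen z \<otimes>\<^bsub>A\<^esub> gen x)"
      unfolding conj_z_iota[OF hc] by (simp only: m_assoc P ic xA z_closed m_closed)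
    finally show ?case unfolding Suc by (simp add: m_assoc ic xA z_closed)
  qed
  have 2: "seqprod A (\<lambda>i. conj_z (?h (Suc i))) n \<otimes>\<^bsub>A\<^esub> \<iota> (?h n) = \<iota> h \<otimes>\<^bsub>A\<^esub> (gen x \<otimes>\<^bsub>A\<^esub> gen z) [^]\<^bsub>A\<^esub> n" for n
  proof (induction n)
    case 0
    then show ?case using h by simp
  next
    case (Suc n)
    have "seqprod A (\<lambda>i. conj_z (?h (Suc i))) (Suc n) \<otimes>\<^bsub>A\<^esub> \<iota> (?h (Suc n))
        = seqprod A (\<lambda>i. conj_z (?h (Suc i))) n \<otimes>\<^bsub>A\<^esub> (conj_z (?h (Suc n)) \<otimes>\<^bsub>A\<^esub> \<iota> (?h (Suc n)))"
      unfolding seqprod.simps by (simp only: m_assoc P sc ic m_closed)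
    also have "\<dots> = seqprod A (\<lambda>i. conj_z (?h (Suc i))) n \<otimes>\<^bsub>A\<^esub> \<iota> (?h n) \<otimes>\<^bsub>A\<^esub> (gen x \<otimes>\<^bsub>A\<^esub> gen z)"
      unfolding conj_z_iota[OF hc] unfolding step by (simp only: m_assoc P ic xA z_closed m_closed)
    finally show ?case unfolding Suc by (simp add: m_assoc ic xA z_closed)
  qed
  have "(gen z \<otimes>\<^bsub>A\<^esub> gen x) [^]\<^bsub>A\<^esub> half {x, z} = (gen x \<otimes>\<^bsub>A\<^esub> gen z) [^]\<^bsub>A\<^esub> half {x, z}"
    using relation[OF x] by simp
  then have "seqprod A (\<lambda>i. conj_z (?h i)) (half {x, z}) \<otimes>\<^bsub>A\<^esub> \<iota> (?h (half {x, z}))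
      = seqprod A (\<lambda>i. conj_z (?h (Suc i))) (half {x, z}) \<otimes>\<^bsub>A\<^esub> \<iota> (?h (half {x, z}))"
    unfolding 1 2 by simp
  then show ?thesis
    unfolding H.window_def using r_cancel[OF _ P(1) P(2) ic(1)] by simp
qed

abbreviation "T \<equiv> H.basis"

lemma T_closed: "t \<in> T \<Longrightarrow> t \<in> carrier B"
  by (simp add: H.basis_def)

lemma conj_z_T_closed: "conj_z ` T \<subseteq> carrier A"
  using conj_z_closed T_closed by blast

abbreviation "Z \<equiv> generate A (conj_z ` T)"

lemma Z_subgroup: "subgroup Z A"
  by (rule generate_is_subgroup[OF conj_z_T_closed])

lemma conj_z_in_Z: "h \<in> carrier B \<Longrightarrow> conj_z h \<in> Z"
  by (rule H.generate_basis[OF is_group]) (use conj_z_closed window_conj_z in auto)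

text \<open>The kernel part of \<open>g\<close> is unchanged when a generator other than
  \<open>z\<close> is appended, and gains the factor \<open>conj_z (\<rho> g)\<close> or its inverse
  when \<open>gen z\<close> or its inverse is.\<close>

lemma factor: "g \<in> carrier A \<Longrightarrow> g \<otimes>\<^bsub>A\<^esub> inv\<^bsub>A\<^esub> \<iota> (\<rho> g) \<in> Z"
proof (induction rule: gen_induct)
  case one
  then show ?case by (simp add: subgroup.one_closed[OF Z_subgroup])
next
  case (gen g v)
  define h where "h = \<rho> g"
  have h: "h \<in> carrier B" "\<iota> h \<in> carrier A" using gen by (simp_all add: h_def)
  have vA: "gen v \<in> carrier A" using gen gen_closed by simp
  show ?case
  proof (cases "v = z")
    case True
    have "g \<otimes>\<^bsub>A\<^esub> gen z \<otimes>\<^bsub>A\<^esub> inv\<^bsub>A\<^esub> \<iota> h = (g \<otimes>\<^bsub>A\<^esub> inv\<^bsub>A\<^esub> \<iota> h) \<otimes>\<^bsub>A\<^esub> conj_z h"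
      using gen(1) h z_closed by (simp add: conj_z_def m_assoc inv_solve_left flip: m_assoc[of "inv\<^bsub>A\<^esub> \<iota> h"])
    moreover have "\<rho> (g \<otimes>\<^bsub>A\<^esub> gen z) = h"
      using gen(1) z_closed h by (simp add: h_def rho_z)
    ultimately show ?thesis
      using subgroup.m_closed[OF Z_subgroup gen(3) conj_z_in_Z[OF h(1)]] True by (simp only: h_def)
  next
    case False
    then have v: "v \<in> V'" using gen by simp
    have "\<iota> (\<rho> (g \<otimes>\<^bsub>A\<^esub> gen v)) = \<iota> h \<otimes>\<^bsub>A\<^esub> gen v"
      using gen(1) vA h H.gen_closed[OF v] by (simp add: h_def rho_gen[OF v] iota_gen[OF v])
    then have "g \<otimes>\<^bsub>A\<^esub> gen v \<otimes>\<^bsub>A\<^esub> inv\<^bsub>A\<^esub> \<iota> (\<rho> (g \<otimes>\<^bsub>A\<^esub> gen v)) = g \<otimes>\<^bsub>A\<^esub> inv\<^bsub>A\<^esub> \<iota> h"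
      using gen(1) vA h by (simp add: inv_mult_group m_assoc flip: m_assoc[of "gen v"])
    then show ?thesis using gen(3) by (simp add: h_def)
  qed
next
  case (inv_gen g v)
  define h where "h = \<rho> g"
  have h: "h \<in> carrier B" "\<iota> h \<in> carrier A" using inv_gen by (simp_all add: h_def)
  have vA: "gen v \<in> carrier A" using inv_gen gen_closed by simp
  show ?case
  proof (cases "v = z")
    case True
    have "inv\<^bsub>A\<^esub> conj_z h = \<iota> h \<otimes>\<^bsub>A\<^esub> inv\<^bsub>A\<^esub> gen z \<otimes>\<^bsub>A\<^esub> inv\<^bsub>A\<^esub> \<iota> h"
      using h z_closed by (simp add: conj_z_def inv_mult_group m_assoc)
    then have "g \<otimes>\<^bsub>A\<^esub> inv\<^bsub>A\<^esub> gen z \<otimes>\<^bsub>A\<^esub> inv\<^bsub>A\<^esub> \<iota> h = (g \<otimes>\<^bsub>A\<^esub> inv\<^bsub>A\<^esub> \<iota> h) \<otimes>\<^bsub>A\<^esub> inv\<^bsub>A\<^esub> conj_z h"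
      using inv_gen(1) h z_closed by (simp add: m_assoc flip: m_assoc[of "inv\<^bsub>A\<^esub> \<iota> h"])
    moreover have "\<rho> (g \<otimes>\<^bsub>A\<^esub> inv\<^bsub>A\<^esub> gen z) = h"
      using inv_gen(1) z_closed h by (simp add: h_def rho_z)
    ultimately show ?thesis
      using subgroup.m_closed[OF Z_subgroup inv_gen(3) subgroup.m_inv_closed[OF Z_subgroup conj_z_in_Z[OF h(1)]]] True
      by (simp only: h_def)
  next
    case False
    then have v: "v \<in> V'" using inv_gen by simp
    have "\<iota> (\<rho> (g \<otimes>\<^bsub>A\<^esub> inv\<^bsub>A\<^esub> gen v)) = \<iota> h \<otimes>\<^bsub>A\<^esub> inv\<^bsub>A\<^esub> gen v"
      using inv_gen(1) vA h H.gen_closed[OF v] by (simp add: h_def rho_gen[OF v] iota_gen[OF v])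
    then have "g \<otimes>\<^bsub>A\<^esub> inv\<^bsub>A\<^esub> gen v \<otimes>\<^bsub>A\<^esub> inv\<^bsub>A\<^esub> \<iota> (\<rho> (g \<otimes>\<^bsub>A\<^esub> inv\<^bsub>A\<^esub> gen v)) = g \<otimes>\<^bsub>A\<^esub> inv\<^bsub>A\<^esub> \<iota> h"
      using inv_gen(1) vA h by (simp add: inv_mult_group m_assoc flip: m_assoc[of "inv\<^bsub>A\<^esub> gen v"])
    then show ?thesis using inv_gen(3) by (simp add: h_def)
  qed
qed

lemma kernel_eq: "kernel A B \<rho> = Z"
proof
  show "Z \<subseteq> kernel A B \<rho>"
    by (rule generate_subgroup_incl[OF _ \<rho>.subgroup_kernel]) (use conj_z_kernel T_closed in blast)
  show "kernel A B \<rho> \<subseteq> Z"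
  proof
    fix g assume "g \<in> kernel A B \<rho>"
    then have "g \<in> carrier A" "\<rho> g = \<one>\<^bsub>B\<^esub>" by (simp_all add: kernel_def)
    then show "g \<in> Z" using factor[of g] by simp
  qed
qed

abbreviation "F \<equiv> free_grp T"
abbreviation \<xi> :: "'a word set \<Rightarrow> 'a word set word" where "\<xi> t \<equiv> [(True, t)]"

lemma xi_closed: "\<xi> ` T \<subseteq> carrier F"
  by (auto simp: free_grp_def reduced_def)

end

section \<open>Freeness of the kernel through an action on a semidirect product\<close>

locale removal_action = split_removal +
  fixes \<zeta> :: "'a word set \<Rightarrow> 'a word set word"
  assumes zeta_closed: "h \<in> carrier B \<Longrightarrow> \<zeta> h \<in> carrier F"
    and zeta_basis: "t \<in> T \<Longrightarrow> \<zeta> t = \<xi> t"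
    and zeta_window: "h \<in> carrier B \<Longrightarrow> {x, z} \<in> E \<Longrightarrow> H.window F \<zeta> h x"
begin

sublocale F: group F by (rule free_grp_group)

abbreviation "D \<equiv> carrier F \<times> carrier B"

text \<open>The right action of \<open>A\<close> on the semidirect product of \<open>F\<close> and \<open>B\<close>, extended by the identity outside its
carrier \<open>D\<close>.\<close>

definition gen_act :: "'a \<Rightarrow> 'a word set word \<times> 'a word set \<Rightarrow> 'a word set word \<times> 'a word set" where
  "gen_act v p = (if p \<notin> D then p
     else if v = z then (fst p \<otimes>\<^bsub>F\<^esub> \<zeta> (snd p), snd p) else (fst p, snd p \<otimes>\<^bsub>B\<^esub> H.gen v))"

definition gen_act_inv :: "'a \<Rightarrow> 'a word set word \<times> 'a word set \<Rightarrow> 'a word set word \<times> 'a word set" where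
  "gen_act_inv v p = (if p \<notin> D then p
     else if v = z then (fst p \<otimes>\<^bsub>F\<^esub> inv\<^bsub>F\<^esub> \<zeta> (snd p), snd p)
     else (fst p, snd p \<otimes>\<^bsub>B\<^esub> inv\<^bsub>B\<^esub> H.gen v))"

lemma bij_gen_act:
  assumes "v \<in> V"
  shows "bij (gen_act v)"
proof (rule o_bij[of "gen_act_inv v"])
  have v: "v \<noteq> z \<Longrightarrow> H.gen v \<in> carrier B" using assms gen'_closed by blast
  show "gen_act_inv v \<circ> gen_act v = id"
  proof
    fix p show "(gen_act_inv v \<circ> gen_act v) p = id p"
      using v zeta_closed by (cases p) (auto simp: gen_act_def gen_act_inv_def F.m_assoc H.m_assoc)
  qed
  show "gen_act v \<circ> gen_act_inv v = id"
  proof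
    fix p show "(gen_act v \<circ> gen_act_inv v) p = id p"
      using v zeta_closed by (cases p) (auto simp: gen_act_def gen_act_inv_def F.m_assoc H.m_assoc)
  qed
qed

lemma gen_act_outside: "p \<notin> D \<Longrightarrow> ((gen_act u \<circ> gen_act v) ^^ n) p = p"
  by (induction n) (simp_all add: gen_act_def)

lemma gen_act_x: "f \<in> carrier F \<Longrightarrow> h \<in> carrier B \<Longrightarrow> x \<in> V' \<Longrightarrow> gen_act x (f, h) = (f, h \<otimes>\<^bsub>B\<^esub> H.gen x)"
  by (simp add: gen_act_def)

lemma gen_act_z: "f \<in> carrier F \<Longrightarrow> h \<in> carrier B \<Longrightarrow> gen_act z (f, h) = (f \<otimes>\<^bsub>F\<^esub> \<zeta> h, h)"
  by (simp add: gen_act_def)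

lemma gen_act_pow_xy:
  assumes "f \<in> carrier F" "h \<in> carrier B" "x \<in> V'" "y \<in> V'"
  shows "((gen_act y \<circ> gen_act x) ^^ n) (f, h) = (f, h \<otimes>\<^bsub>B\<^esub> (H.gen x \<otimes>\<^bsub>B\<^esub> H.gen y) [^]\<^bsub>B\<^esub> n)"
proof (induction n)
  case 0
  then show ?case using assms by simp
next
  case (Suc n)
  have g: "H.gen x \<in> carrier B" "H.gen y \<in> carrier B" using assms H.gen_closed by blast+
  define k where "k = h \<otimes>\<^bsub>B\<^esub> (H.gen x \<otimes>\<^bsub>B\<^esub> H.gen y) [^]\<^bsub>B\<^esub> n"
  have k: "k \<in> carrier B" using assms g by (simp add: k_def)
  have "((gen_act y \<circ> gen_act x) ^^ Suc n) (f, h) = gen_act y (gen_act x (f, k))"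
    by (simp only: funpow.simps comp_apply Suc k_def)
  also have "\<dots> = (f, k \<otimes>\<^bsub>B\<^esub> H.gen x \<otimes>\<^bsub>B\<^esub> H.gen y)"
    using assms k g by (simp add: gen_act_x)
  also have "k \<otimes>\<^bsub>B\<^esub> H.gen x \<otimes>\<^bsub>B\<^esub> H.gen y = h \<otimes>\<^bsub>B\<^esub> (H.gen x \<otimes>\<^bsub>B\<^esub> H.gen y) [^]\<^bsub>B\<^esub> Suc n"
    using assms g by (simp add: k_def H.m_assoc)
  finally show ?case .
qed

text \<open>The first coordinate collects the left side of the window at \<open>h\<close> if
  \<open>z\<close> acts first and the right side if \<open>x\<close> does, so the windows for
  \<zeta> are precisely the Artin relations for this action.\<close>

lemma gen_act_pow_z:
  assumes f: "f \<in> carrier F" and h: "h \<in> carrier B" and x: "x \<in> V'"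
  shows "((gen_act x \<circ> gen_act z) ^^ n) (f, h)
        = (f \<otimes>\<^bsub>F\<^esub> seqprod F (\<lambda>i. \<zeta> (h \<otimes>\<^bsub>B\<^esub> H.gpow x (int i))) n, h \<otimes>\<^bsub>B\<^esub> H.gpow x (int n)) \<and>
      ((gen_act z \<circ> gen_act x) ^^ n) (f, h)
        = (f \<otimes>\<^bsub>F\<^esub> seqprod F (\<lambda>i. \<zeta> (h \<otimes>\<^bsub>B\<^esub> H.gpow x (int (Suc i)))) n, h \<otimes>\<^bsub>B\<^esub> H.gpow x (int n))"
proof (induction n)
  case 0
  then show ?case using f h by simp
next
  case (Suc n)
  have hc: "h \<otimes>\<^bsub>B\<^esub> H.gpow x i \<in> carrier B" for i using h x by simp
  have zc: "\<zeta> (h \<otimes>\<^bsub>B\<^esub> H.gpow x i) \<in> carrier F" for i using zeta_closed hc by blast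
  define P where "P = seqprod F (\<lambda>i. \<zeta> (h \<otimes>\<^bsub>B\<^esub> H.gpow x (int i))) n"
  define Q where "Q = seqprod F (\<lambda>i. \<zeta> (h \<otimes>\<^bsub>B\<^esub> H.gpow x (int (Suc i)))) n"
  have PQ: "P \<in> carrier F" "Q \<in> carrier F"
    unfolding P_def Q_def by (rule F.seqprod_closed, rule zc)+
  have e: "h \<otimes>\<^bsub>B\<^esub> H.gpow x (int n) \<otimes>\<^bsub>B\<^esub> H.gen x = h \<otimes>\<^bsub>B\<^esub> H.gpow x (int (Suc n))"
    using H.mult_gpow_gen[OF h x, of "int n"] by (simp add: add.commute)
  have a: "((gen_act x \<circ> gen_act z) ^^ Suc n) (f, h) = gen_act x (gen_act z (f \<otimes>\<^bsub>F\<^esub> P, h \<otimes>\<^bsub>B\<^esub> H.gpow x (int n)))"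
    by (simp only: funpow.simps comp_apply Suc P_def)
  have b: "((gen_act z \<circ> gen_act x) ^^ Suc n) (f, h) = gen_act z (gen_act x (f \<otimes>\<^bsub>F\<^esub> Q, h \<otimes>\<^bsub>B\<^esub> H.gpow x (int n)))"
    by (simp only: funpow.simps comp_apply Suc Q_def)
  show ?case
    unfolding a b seqprod.simps P_def[symmetric] Q_def[symmetric]
    by (simp only: gen_act_z gen_act_x[OF _ _ x] F.m_closed f PQ zc hc e F.m_assoc simp_thms)
qed

lemma gen_act_relation_z:
  assumes x: "{x, z} \<in> E"
  shows "(gen_act x \<circ> gen_act z) ^^ half {x, z} = (gen_act z \<circ> gen_act x) ^^ half {x, z}"
proof
  fix p
  have V: "x \<in> V'" using edge_vertices[OF x] by auto
  show "((gen_act x \<circ> gen_act z) ^^ half {x, z}) p = ((gen_act z \<circ> gen_act x) ^^ half {x, z}) p"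
  proof (cases "p \<in> D")
    case True
    obtain f h where p: "p = (f, h)" by (cases p)
    then have fh: "f \<in> carrier F" "h \<in> carrier B" using True by simp_all
    show ?thesis
      using gen_act_pow_z[OF fh V, of "half {x, z}"] zeta_window[OF fh(2) x] p by (simp add: H.window_def)
  next
    case False
    show ?thesis unfolding gen_act_outside[OF False] ..
  qed
qed

lemma gen_act_relation:
  assumes uv: "{u, v} \<in> E"
  shows "(gen_act v \<circ> gen_act u) ^^ half {u, v} = (gen_act u \<circ> gen_act v) ^^ half {u, v}"
proof -
  consider "u = z" | "v = z" | "u \<noteq> z" "v \<noteq> z" by blast
  then show ?thesis
  proof cases
    case 1
    then show ?thesis using gen_act_relation_z[of v] uv by (simp add: insert_commute)
  next
    case 2
    then show ?thesis using gen_act_relation_z[of u] uv by simp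
  next
    case 3
    then have V: "u \<in> V'" "v \<in> V'" using edge_vertices[OF uv] by auto
    have "{u, v} \<in> E'" using uv 3 by auto
    note r = H.relation[OF this]
    show ?thesis
    proof
      fix p
      show "((gen_act v \<circ> gen_act u) ^^ half {u, v}) p = ((gen_act u \<circ> gen_act v) ^^ half {u, v}) p"
      proof (cases "p \<in> D")
        case True
        obtain f h where p: "p = (f, h)" by (cases p)
        then have fh: "f \<in> carrier F" "h \<in> carrier B" using True by simp_all
        show ?thesis unfolding p gen_act_pow_xy[OF fh V] gen_act_pow_xy[OF fh V(2,1)] r ..
      next
        case False
        show ?thesis unfolding gen_act_outside[OF False] ..
      qed
    qed
  qed
qed

lemma ex_Psi: "\<exists>\<Psi>\<in>hom A perm_group. \<forall>v\<in>V. \<Psi> (gen v) = gen_act v"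
proof -
  obtain \<Psi> where "\<Psi> \<in> hom A perm_group" "\<And>v. v \<in> V \<Longrightarrow> \<Psi> (gen v) = gen_act v"
  proof (rule universal[of perm_group gen_act])
    show "gen_act v \<in> carrier perm_group" if "v \<in> V" for v
      using bij_gen_act[OF that] by simp
  qed (simp_all add: perm_group_group perm_group_pow gen_act_relation)
  then show ?thesis by blast
qed

text \<open>On \<open>(f, \<one>)\<close> the element \<open>conj_z t\<close> moves the second
  coordinate to \<open>t\<close>, multiplies the first by \<zeta> t, and moves back. For
  \<open>t\<close> in the basis \<zeta> t is the letter itself, so \<open>w\<close> sends the
  identity to the reduced word \<open>w\<close>.\<close>

lemma ev_conj_z_nontrivial:
  assumes w: "w \<noteq> []" "reduced w" "snd ` set w \<subseteq> T"
  shows "ev A conj_z w \<noteq> \<one>\<^bsub>A\<^esub>"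
proof
  assume triv: "ev A conj_z w = \<one>\<^bsub>A\<^esub>"
  obtain \<Psi> where Psi: "\<Psi> \<in> hom A perm_group" "\<forall>v\<in>V. \<Psi> (gen v) = gen_act v"
    using ex_Psi by (elim bexE)
  have "group_hom A perm_group \<Psi>"
    using Psi(1) is_group perm_group_group by (intro group_hom.intro group_hom_axioms.intro)
  then interpret \<Psi>: group_hom A perm_group \<Psi> .
  have Psi_one: "\<Psi> \<one>\<^bsub>A\<^esub> p = p" for p using \<Psi>.hom_one by simp
  have mult: "\<Psi> (g \<otimes>\<^bsub>A\<^esub> g') p = \<Psi> g' (\<Psi> g p)" if "g \<in> carrier A" "g' \<in> carrier A" for g g' p
    using \<Psi>.hom_mult[OF that] by simp
  have undo: "\<Psi> (inv\<^bsub>A\<^esub> g) (\<Psi> g p) = p" if "g \<in> carrier A" for g p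
    using mult[of g "inv\<^bsub>A\<^esub> g" p] that Psi_one by (simp only: r_inv inv_closed)
  have Psi_iota: "\<Psi> (\<iota> h) (f, k) = (f, k \<otimes>\<^bsub>B\<^esub> h)"
    if "h \<in> carrier B" "f \<in> carrier F" "k \<in> carrier B" for f h k
    using that
  proof (induction rule: H.gen_induct)
    case one
    then show ?case by (simp only: \<iota>.hom_one Psi_one H.r_one)
  next
    case (gen h v)
    have c: "H.gen v \<in> carrier B" "gen v \<in> carrier A" "v \<in> V"
      using gen(2) H.gen_closed gen_closed by auto
    have "\<Psi> (\<iota> (h \<otimes>\<^bsub>B\<^esub> H.gen v)) (f, k) = \<Psi> (gen v) (\<Psi> (\<iota> h) (f, k))"
      using gen(1) c by (simp only: \<iota>.hom_mult iota_gen[OF gen(2)] mult \<iota>.hom_closed)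
    also have "\<dots> = (f, k \<otimes>\<^bsub>B\<^esub> h \<otimes>\<^bsub>B\<^esub> H.gen v)"
      using gen c Psi(2) by (simp only: gen_act_x H.m_closed bspec[OF Psi(2)])
    finally show ?case using gen c by (simp only: H.m_assoc)
  next
    case (inv_gen h v)
    have c: "H.gen v \<in> carrier B" "gen v \<in> carrier A" "v \<in> V"
      using inv_gen(2) H.gen_closed gen_closed by auto
    let ?k = "k \<otimes>\<^bsub>B\<^esub> (h \<otimes>\<^bsub>B\<^esub> inv\<^bsub>B\<^esub> H.gen v)"
    have "\<Psi> (gen v) (f, ?k) = (f, ?k \<otimes>\<^bsub>B\<^esub> H.gen v)"
      using inv_gen c by (simp only: bspec[OF Psi(2)] gen_act_x H.m_closed H.inv_closed)
    also have "?k \<otimes>\<^bsub>B\<^esub> H.gen v = k \<otimes>\<^bsub>B\<^esub> h"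
      using inv_gen c by (simp only: H.m_assoc H.m_closed H.inv_closed H.l_inv H.r_one)
    also have "(f, k \<otimes>\<^bsub>B\<^esub> h) = \<Psi> (\<iota> h) (f, k)" using inv_gen by (simp only:)
    finally have "\<Psi> (inv\<^bsub>A\<^esub> gen v) (\<Psi> (\<iota> h) (f, k)) = (f, ?k)"
      using undo[OF c(2), of "(f, ?k)"] by (simp only:)
    then show ?case
      using inv_gen(1) c by (simp only: \<iota>.hom_mult \<iota>.hom_inv H.inv_closed iota_gen[OF inv_gen(2)] mult \<iota>.hom_closed inv_closed)
  qed
  have Psi_s: "\<Psi> (conj_z t) (f, \<one>\<^bsub>B\<^esub>) = (f \<otimes>\<^bsub>F\<^esub> \<zeta> t, \<one>\<^bsub>B\<^esub>)" if t: "t \<in> carrier B" and f: "f \<in> carrier F" for t f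
  proof -
    have 1: "\<Psi> (\<iota> t) (f', \<one>\<^bsub>B\<^esub>) = (f', t)" if "f' \<in> carrier F" for f'
      using Psi_iota[OF t that H.one_closed] t by (simp only: H.l_one)
    have "\<Psi> (conj_z t) (f, \<one>\<^bsub>B\<^esub>) = \<Psi> (inv\<^bsub>A\<^esub> \<iota> t) (\<Psi> (gen z) (\<Psi> (\<iota> t) (f, \<one>\<^bsub>B\<^esub>)))"
      using t z_closed by (simp only: conj_z_def mult \<iota>.hom_closed inv_closed m_closed)
    also have "\<Psi> (gen z) (\<Psi> (\<iota> t) (f, \<one>\<^bsub>B\<^esub>)) = (f \<otimes>\<^bsub>F\<^esub> \<zeta> t, t)"
      unfolding 1[OF f] bspec[OF Psi(2) z] gen_act_z[OF f t] ..
    also have "\<dots> = \<Psi> (\<iota> t) (f \<otimes>\<^bsub>F\<^esub> \<zeta> t, \<one>\<^bsub>B\<^esub>)"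
      using 1[OF F.m_closed[OF f zeta_closed[OF t]]] by (rule sym)
    finally show ?thesis unfolding undo[OF \<iota>.hom_closed[OF t]] .
  qed
  have Psi_s_inv: "\<Psi> (inv\<^bsub>A\<^esub> conj_z t) (f, \<one>\<^bsub>B\<^esub>) = (f \<otimes>\<^bsub>F\<^esub> inv\<^bsub>F\<^esub> \<zeta> t, \<one>\<^bsub>B\<^esub>)"
    if t: "t \<in> carrier B" and f: "f \<in> carrier F" for t f
  proof -
    have "\<Psi> (conj_z t) (f \<otimes>\<^bsub>F\<^esub> inv\<^bsub>F\<^esub> \<zeta> t, \<one>\<^bsub>B\<^esub>) = (f, \<one>\<^bsub>B\<^esub>)"
      using Psi_s[OF t] zeta_closed[OF t] f
      by (simp only: F.m_closed F.inv_closed F.m_assoc F.l_inv F.r_one)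
    then show ?thesis
      using undo[OF conj_z_closed[OF t], of "(f \<otimes>\<^bsub>F\<^esub> inv\<^bsub>F\<^esub> \<zeta> t, \<one>\<^bsub>B\<^esub>)"] by (simp only:)
  qed
  have Psi_w: "\<Psi> (ev A conj_z w) (f, \<one>\<^bsub>B\<^esub>) = (f \<otimes>\<^bsub>F\<^esub> ev F \<xi> w, \<one>\<^bsub>B\<^esub>)"
    if "snd ` set w \<subseteq> T" "f \<in> carrier F" for w f
    using that
  proof (induction w arbitrary: f)
    case Nil
    then show ?case by (simp only: ev_Nil Psi_one F.r_one)
  next
    case (Cons x w)
    have t: "snd x \<in> T" "snd ` set w \<subseteq> T" using Cons.prems by auto
    have tB: "snd x \<in> carrier B" by (rule T_closed[OF t(1)])
    have wA: "ev A conj_z w \<in> carrier A" by (rule ev_closed) (use t(2) conj_z_T_closed in blast)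
    have wF: "ev F \<xi> w \<in> carrier F" by (rule F.ev_closed) (use t(2) xi_closed in blast)
    define a where "a = (if fst x then conj_z (snd x) else inv\<^bsub>A\<^esub> conj_z (snd x))"
    define c where "c = (if fst x then \<xi> (snd x) else inv\<^bsub>F\<^esub> \<xi> (snd x))"
    have aA: "a \<in> carrier A" using conj_z_closed[OF tB] by (simp add: a_def)
    have xF: "\<xi> (snd x) \<in> carrier F" using xi_closed t(1) by blast
    have cF: "c \<in> carrier F" using xF F.inv_closed[OF xF] by (simp add: c_def)
    have "\<Psi> a (f, \<one>\<^bsub>B\<^esub>) = (f \<otimes>\<^bsub>F\<^esub> c, \<one>\<^bsub>B\<^esub>)"
      unfolding a_def c_def using Psi_s[OF tB Cons.prems(2)] Psi_s_inv[OF tB Cons.prems(2)] zeta_basis[OF t(1)]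
      by (simp only: if_True if_False split: if_split) simp
    then have "\<Psi> (a \<otimes>\<^bsub>A\<^esub> ev A conj_z w) (f, \<one>\<^bsub>B\<^esub>) = \<Psi> (ev A conj_z w) (f \<otimes>\<^bsub>F\<^esub> c, \<one>\<^bsub>B\<^esub>)"
      using mult[OF aA wA] by (simp only:)
    also have "\<dots> = (f \<otimes>\<^bsub>F\<^esub> c \<otimes>\<^bsub>F\<^esub> ev F \<xi> w, \<one>\<^bsub>B\<^esub>)"
      by (rule Cons.IH[OF t(2) F.m_closed[OF Cons.prems(2) cF]])
    also have "f \<otimes>\<^bsub>F\<^esub> c \<otimes>\<^bsub>F\<^esub> ev F \<xi> w = f \<otimes>\<^bsub>F\<^esub> (c \<otimes>\<^bsub>F\<^esub> ev F \<xi> w)"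
      by (rule F.m_assoc[OF Cons.prems(2) cF wF])
    finally show ?case unfolding ev_Cons a_def c_def .
  qed
  have c: "ev F \<xi> w \<in> carrier F" by (rule F.ev_closed) (use w(3) xi_closed in blast)
  have "(\<one>\<^bsub>F\<^esub>, \<one>\<^bsub>B\<^esub>) = (ev F \<xi> w, \<one>\<^bsub>B\<^esub>)"
    using Psi_w[OF w(3) F.one_closed] unfolding triv Psi_one F.l_one[OF c] .
  then have "ev F \<xi> w = \<one>\<^bsub>F\<^esub>" by simp
  then have "w = []" using ev_free_grp[OF w(2,3)] by (simp add: free_grp_def)
  then show False using w(1) by contradiction
qed

lemma kernel_free: "is_free_group (A\<lparr>carrier := kernel A B \<rho>\<rparr>)"
proof (rule is_free_groupI)
  let ?K = "kernel A B \<rho>"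
  let ?AK = "A\<lparr>carrier := ?K\<rparr>"
  show "group ?AK" by (rule subgroup_imp_group[OF \<rho>.subgroup_kernel])
  have sK: "conj_z ` T \<subseteq> ?K" using conj_z_kernel T_closed by blast
  then show "conj_z ` T \<subseteq> carrier ?AK" by simp
  show "generate ?AK (conj_z ` T) = carrier ?AK"
    using generate_consistent[OF sK \<rho>.subgroup_kernel] kernel_eq by simp
  have evK: "ev ?AK conj_z w = ev A conj_z w" if "snd ` set w \<subseteq> T" for w
    using that
  proof (induction w)
    case (Cons x w)
    have "conj_z (snd x) \<in> ?K" using sK Cons.prems by auto
    then have "inv\<^bsub>?AK\<^esub> conj_z (snd x) = inv\<^bsub>A\<^esub> conj_z (snd x)"
      by (rule m_inv_consistent[OF \<rho>.subgroup_kernel])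
    then show ?case using Cons by (simp add: ev_Cons)
  qed simp
  fix w assume w: "w \<noteq> []" "reduced w" "snd ` set w \<subseteq> T"
  show "ev ?AK conj_z w \<noteq> \<one>\<^bsub>?AK\<^esub>"
    using ev_conj_z_nontrivial[OF w] evK[OF w(3)] by simp
qed

end

context vertex_removal
begin

lemma free_kernel_retraction:
  "\<exists>\<rho>. group_hom A B \<rho> \<and> \<rho> ` carrier A = carrier B \<and> is_free_group (A\<lparr>carrier := kernel A B \<rho>\<rparr>)"
proof -
  obtain \<rho> where \<rho>: "\<rho> \<in> hom A B" "\<rho> (gen z) = \<one>\<^bsub>B\<^esub>" "\<forall>v\<in>V'. \<rho> (gen v) = H.gen v"
    using ex_retraction by (elim bexE conjE)
  obtain \<iota> where \<iota>: "\<iota> \<in> hom B A" "\<forall>v\<in>V'. \<iota> (H.gen v) = gen v"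
    using ex_section by (elim bexE)
  have split: "split_removal V E m z \<rho> \<iota>"
    by (intro split_removal.intro split_removal_axioms.intro vertex_removal_axioms \<rho>(1,2) \<iota>(1)
        bspec[OF \<rho>(3)] bspec[OF \<iota>(2)])
  interpret S: split_removal V E m z \<rho> \<iota> by (rule split)
  have "\<exists>\<zeta>. (\<forall>h\<in>carrier B. \<zeta> h \<in> carrier S.F) \<and> (\<forall>t\<in>S.T. \<zeta> t = S.\<xi> t) \<and>
      (\<forall>h\<in>carrier B. \<forall>x. {x, z} \<in> E \<longrightarrow> H.window S.F \<zeta> h x)"
    by (rule H.ex_elimination[OF free_grp_group S.xi_closed]) blast
  then obtain \<zeta> where \<zeta>: "\<forall>h\<in>carrier B. \<zeta> h \<in> carrier S.F" "\<forall>t\<in>S.T. \<zeta> t = S.\<xi> t"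
    "\<forall>h\<in>carrier B. \<forall>x. {x, z} \<in> E \<longrightarrow> H.window S.F \<zeta> h x"
    by (elim exE conjE)
  have "removal_action V E m z \<rho> \<iota> \<zeta>"
    using \<zeta> by (intro removal_action.intro removal_action_axioms.intro split) blast+
  then have "is_free_group (A\<lparr>carrier := kernel A B \<rho>\<rparr>)"
    by (rule removal_action.kernel_free)
  then show ?thesis
    using S.\<rho>.group_hom_axioms S.rho_surj by (intro exI[of _ \<rho>] conjI)
qed

end

theorem theoremA:
  fixes V :: "'v set" and E :: "'v set set" and m :: "'v set \<Rightarrow> nat"
  assumes "labelled_graph V E m"
    and "even_artin E m"
    and "large_artin E m"
  shows "poly_free (artin_group V E m)"
proof -
  have "finite V" using assms(1) by (simp add: labelled_graph_def)
  then show ?thesis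
    using assms
  proof (induction V arbitrary: E rule: finite_psubset_induct)
    case (psubset V)
    interpret large_even_graph V E m
      using psubset.prems by unfold_locales
    show ?case
    proof (cases "V = {}")
      case True
      have "carrier A = {\<one>\<^bsub>A\<^esub>}"
      proof -
        have "g = \<one>\<^bsub>A\<^esub>" if "g \<in> carrier A" for g
          using that by (induction rule: gen_induct) (simp_all add: True)
        then show ?thesis by auto
      qed
      then show ?thesis
        unfolding poly_free_def using is_group by (intro conjI exI[of _ 0] exI[of _ "\<lambda>_. {\<one>\<^bsub>A\<^esub>}"]) auto
    next
      case False
      then obtain z where z: "z \<in> V" by blast
      interpret vertex_removal V E m z by unfold_locales (rule z)
      obtain \<rho> where \<rho>: "group_hom A B \<rho>" "\<rho> ` carrier A = carrier B"
        "is_free_group (A\<lparr>carrier := kernel A B \<rho>\<rparr>)"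
        using free_kernel_retraction by (elim exE conjE)
      have "poly_free B"
        using z H.graph H.even_m H.large by (intro psubset.IH) auto
      then show ?thesis by (rule poly_free_extension[OF \<rho>])
    qed
  qed
qed

end
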